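(* Consider the linear mixed model $y_{ij}=\alpha+x_{ij}'\beta+b_i+\varepsilon_{ij}$, $1\le i\le n$, $1\le j\le l_i$, with the estimators $\hat\beta$, $\hat\alpha$ described in the context, and suppose $\gamma_\varepsilon^2=\mathbb{E}\varepsilon_{ij}^2<\infty$ and $\gamma_b^2=\mathbb{E}b_i^2<\infty$. Assume that (1) $\lim_{n\to\infty}\hat\Sigma_n=\Sigma$ for some positive definite $p\times p$ matrix $\Sigma$; (2) $\frac1n\sum_{i=1}^n\frac1{l_i}\to0$ and $N/n\to\infty$ as $n\to\infty$; (3) $\frac{\max_{1\le i\le n,\,1\le j\le l_i}\|x_{ij}-\bar x_{i\cdot}\|}{\sqrt N}\to0$ as $n\to\infty$, and $\frac1n\sum_{i=1}^n\bar x_{i\cdot}$ is bounded in $n$. Then, in distribution as $n\to\infty$, $$N^{1/2}(\hat\beta-\beta)\to\mathcal N_p(0,\gamma_\varepsilon^2\Sigma^{-1})\qquad\text{and}\qquad n^{1/2}(\hat\alpha-\alpha)\to\mathcal N_1(0,\gamma_b^2).$$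
   Context: Model. One observes $(x_{ij},y_{ij})$, $1\le i\le n$, $1\le j\le l_i$, satisfying $y_{ij}=\alpha+x_{ij}'\beta+b_i+\varepsilon_{ij}$, where $i$ indexes groups, $l_i\ge1$ is the integer size of group $i$, $x_{ij}\in\mathbb R^p$ are (nonrandom) column vectors ($p$ fixed), $\alpha\in\mathbb R$ and $\beta\in\mathbb R^p$ are unknown parameters, $b_1,b_2,\dots$ are i.i.d. real random variables, independent of all $\varepsilon_{ij}$, the $\varepsilon_{ij}$ are i.i.d. real random variables, and $\mathbb E b_i=0=\mathbb E\varepsilon_{ij}$. A prime denotes transpose. $\mathcal N_q(\mu,V)$ is the $q$-dimensional normal distribution with mean $\mu$ and covariance $V$. Notation. $N=\sum_{i=1}^n l_i$; $\bar x_{i\cdot}=\frac1{l_i}\sum_{j=1}^{l_i}x_{ij}$, $\bar y_{i\cdot}=\frac1{l_i}\sum_{j=1}^{l_i}y_{ij}$; $$\hat\Sigma_n=\frac1N\sum_{i=1}^n\sum_{j=1}^{l_i}(x_{ij}-\bar x_{i\cdot})(x_{ij}-\bar x_{i\cdot})'.$$ Estimators (defined whenever $\hat\Sigma_n$ is invertible, in particular for all large $n$ when $\hat\Sigma_n$ converges to a positive definite matrix): $$\hat\beta=\hat\Sigma_n^{-1}\,\frac{\sum_{i=1}^n\sum_{j=1}^{l_i}(x_{ij}-\bar x_{i\cdot})(y_{ij}-\bar y_{i\cdot})}{N},\qquad \hat\alpha=\frac1n\sum_{i=1}^n\bar y_{i\cdot}-\frac1n\sum_{i=1}^n\bar x_{i\cdot}'\hat\beta.$$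 *)

theory Defs
  imports "HOL-Probability.Probability"
begin

definition pos_def :: "real^'p^'p \<Rightarrow> bool" where
  "pos_def A \<longleftrightarrow> transpose A = A \<and> (\<forall>v. v \<noteq> 0 \<longrightarrow> v \<bullet> (A *v v) > 0)"

text \<open>
  Convergence in distribution of Borel measures on a general topological space. On the real
  line the library's \<open>weak_conv_m\<close> is used instead.
\<close>

definition weak_conv_gen :: "(nat \<Rightarrow> 'v::topological_space measure) \<Rightarrow> 'v measure \<Rightarrow> bool" where
  "weak_conv_gen \<mu> \<nu> \<longleftrightarrow>
     (\<forall>f::'v \<Rightarrow> real. continuous_on UNIV f \<longrightarrow> bounded (range f) \<longrightarrow>
        (\<lambda>n. integral\<^sup>L (\<mu> n) f) \<longlonglongrightarrow> integral\<^sup>L \<nu> f)"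

definition std_mv_normal :: "(real^'p) measure" where
  "std_mv_normal = density lborel (\<lambda>z. ennreal (\<Prod>k\<in>UNIV. std_normal_density (z $ k)))"

text \<open>
  The normal law with mean \<open>m\<close> and covariance \<open>V\<close> is the law of \<open>m + A Z\<close> for \<open>Z\<close> standard
  normal and \<open>A A' = V\<close>. Such an \<open>A\<close> exists whenever \<open>V\<close> is symmetric positive semidefinite,
  and the law depends on \<open>A\<close> only through \<open>A A'\<close>. Unlike a definition by a density, this
  covers singular \<open>V\<close>; in particular \<open>V = 0\<close> gives the point mass at \<open>m\<close>.
\<close>

definition mv_normal :: "real^'p \<Rightarrow> real^'p^'p \<Rightarrow> (real^'p) measure" where
  "mv_normal m V = distr std_mv_normal borel (\<lambda>z. m + (SOME A::real^'p^'p. A ** transpose A = V) *v z)"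

text \<open>The one-dimensional case, parametrised by the variance; \<open>v = 0\<close> is allowed.\<close>

definition normal_law :: "real \<Rightarrow> real \<Rightarrow> real measure" where
  "normal_law m v = distr std_normal_distribution borel (\<lambda>z. m + sqrt v * z)"

text \<open>
  In the following, groups are indexed by \<open>i \<ge> 1\<close> and the members of group \<open>i\<close> by
  \<open>1 \<le> j \<le> l i\<close>; values at other indices are never used.
\<close>

definition total_size :: "(nat \<Rightarrow> nat) \<Rightarrow> nat \<Rightarrow> nat" where
  "total_size l n = (\<Sum>i=1..n. l i)"

definition group_mean :: "(nat \<Rightarrow> nat) \<Rightarrow> (nat \<Rightarrow> nat \<Rightarrow> 'v::real_vector) \<Rightarrow> nat \<Rightarrow> 'v" where
  "group_mean l z i = (1 / real (l i)) *\<^sub>R (\<Sum>j=1..l i. z i j)"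

definition outer :: "real^'p \<Rightarrow> real^'p^'p" where
  "outer v = (columnvector v :: real^1^'p) ** rowvector v"

definition Sigma_hat :: "(nat \<Rightarrow> nat) \<Rightarrow> (nat \<Rightarrow> nat \<Rightarrow> real^'p) \<Rightarrow> nat \<Rightarrow> real^'p^'p" where
  "Sigma_hat l x n =
     (1 / real (total_size l n)) *\<^sub>R
       (\<Sum>i=1..n. \<Sum>j=1..l i. outer (x i j - group_mean l x i))"

text \<open>
  The estimators are meaningful only if \<open>Sigma_hat l x n\<close> is invertible; otherwise
  \<open>matrix_inv\<close> yields an unspecified (but nonrandom) matrix.
\<close>

definition beta_hat ::
  "(nat \<Rightarrow> nat) \<Rightarrow> (nat \<Rightarrow> nat \<Rightarrow> real^'p) \<Rightarrow> (nat \<Rightarrow> nat \<Rightarrow> real) \<Rightarrow> nat \<Rightarrow> real^'p" where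
  "beta_hat l x y n =
     matrix_inv (Sigma_hat l x n) *v
       ((1 / real (total_size l n)) *\<^sub>R
         (\<Sum>i=1..n. \<Sum>j=1..l i.
            (y i j - group_mean l y i) *\<^sub>R (x i j - group_mean l x i)))"

definition alpha_hat ::
  "(nat \<Rightarrow> nat) \<Rightarrow> (nat \<Rightarrow> nat \<Rightarrow> real^'p) \<Rightarrow> (nat \<Rightarrow> nat \<Rightarrow> real) \<Rightarrow> nat \<Rightarrow> real" where
  "alpha_hat l x y n =
     (1 / real n) * (\<Sum>i=1..n. group_mean l y i) -
     (1 / real n) * (\<Sum>i=1..n. group_mean l x i \<bullet> beta_hat l x y n)"

definition obs_index :: "(nat \<Rightarrow> nat) \<Rightarrow> (nat \<times> nat) set" where
  "obs_index l = {(i, j). 1 \<le> i \<and> 1 \<le> j \<and> j \<le> l i}"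

end

theory Submission
  imports Defs
begin

text \<open>
  Within each group, subtracting group means removes \<open>\<alpha>\<close>, the random effect \<open>b i\<close> and, because
  deviations from a mean sum to zero, the averaged noise. Hence, as soon as
  \<open>Sigma_hat\<close> is invertible, \<open>beta_hat - \<beta>\<close> is a nonrandom linear function of the noise
  \<open>eps\<close> alone (\<open>beta_hat_error\<close>). For a fixed direction \<open>t\<close>, the squared weights of
  \<open>sqrt N * (t \<bullet> (beta_hat - \<beta>))\<close> sum to exactly \<open>t \<bullet> Sigma_hat\<^sup>-\<^sup>1 t\<close>
  (\<open>estimator_weights_square_sum\<close>), which tends to \<open>t \<bullet> \<Sigma>\<^sup>-\<^sup>1 t\<close>, and each single weight is at most
  a constant times the largest deviation divided by \<open>sqrt N\<close>, which tends to zero. This is the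
  situation of the central limit theorem for weighted sums of i.i.d. variables
  (\<open>weighted_sum_clt\<close>): when the squared weights have a convergent sum and the single weights are uniformly small, the
  product of the characteristic functions of the summands has the same limit as the product of the
  Gaussian ones. The Cramer-Wold device (\<open>cramer_wold\<close>) turns the convergence of all these
  projections into convergence in distribution of the random vectors.

  The error of \<open>alpha_hat\<close> is the average of the \<open>b i\<close> plus a linear function of the noise
  (\<open>alpha_hat_error\<close>). After multiplication by \<open>sqrt n\<close> the first part converges to the stated
  normal law by the same central limit theorem. The second moment of the second part is at most a
  constant times the mean of \<open>1 / l i\<close>, from averaging the noise within groups, plus a
  constant times \<open>n / N\<close>, from the error of \<open>beta_hat\<close>, whose own order is \<open>1 / sqrt N\<close>. Both
  tend to zero, so this part does not affect the limit (\<open>slutsky_mean_square\<close>).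
\<close>

section \<open>Trigonometric polynomials and the Cramer-Wold device\<close>

text \<open>
  Finite sums of phase-shifted waves, with the phase \<open>s\<close> making sines special cases. The integral
  of a single wave depends only on the law of one projection \<open>t \<bullet> x\<close>, which is why these functions are the
  link between one-dimensional and multivariate convergence in distribution.
\<close>

inductive trig_poly :: "('v::euclidean_space \<Rightarrow> real) \<Rightarrow> bool" where
  wave: "trig_poly (\<lambda>x. a * cos (t \<bullet> x + s))"
| add: "trig_poly f \<Longrightarrow> trig_poly g \<Longrightarrow> trig_poly (\<lambda>x. f x + g x)"

lemma trig_poly_const: "trig_poly (\<lambda>x. a)"
  using trig_poly.wave[of a 0 0] by simp

lemma trig_poly_sum:
  assumes "finite A" "\<And>i. i \<in> A \<Longrightarrow> trig_poly (f i)"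
  shows "trig_poly (\<lambda>x. \<Sum>i\<in>A. f i x)"
  using assms by (induction A rule: finite_induct) (auto intro: trig_poly_const trig_poly.add)

text \<open>By the product-to-sum formula a product of two waves is again a sum of two waves.\<close>

lemma trig_poly_mult:
  assumes "trig_poly f" "trig_poly g"
  shows "trig_poly (\<lambda>x. f x * g x)"
  using assms
proof (induction f arbitrary: g)
  case (wave a t s)
  from wave.prems show ?case
  proof (induction g)
    case (wave b t' s')
    have "(\<lambda>x. a * cos (t \<bullet> x + s) * (b * cos (t' \<bullet> x + s')))
      = (\<lambda>x. a * b / 2 * cos ((t - t') \<bullet> x + (s - s')) + a * b / 2 * cos ((t + t') \<bullet> x + (s + s')))"
    proof
      fix x
      have "cos (t \<bullet> x + s) * cos (t' \<bullet> x + s')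
          = (cos ((t - t') \<bullet> x + (s - s')) + cos ((t + t') \<bullet> x + (s + s'))) / 2"
        by (subst cos_times_cos) (simp add: inner_diff_left inner_add_left algebra_simps)
      thus "a * cos (t \<bullet> x + s) * (b * cos (t' \<bullet> x + s'))
        = a * b / 2 * cos ((t - t') \<bullet> x + (s - s')) + a * b / 2 * cos ((t + t') \<bullet> x + (s + s'))"
        by (simp add: field_simps)
    qed
    thus ?case by (simp only:) (intro trig_poly.intros)
  next
    case (add f g)
    from trig_poly.add[OF add.IH] show ?case by (simp add: algebra_simps)
  qed
next
  case (add f1 f2)
  from trig_poly.add[OF add.IH(1)[OF add.prems] add.IH(2)[OF add.prems]]
  show ?case by (simp add: algebra_simps)
qed

lemma trig_poly_continuous: "trig_poly f \<Longrightarrow> continuous_on UNIV f"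
  by (induction rule: trig_poly.induct) (auto intro!: continuous_intros)

lemma trig_poly_bounded: "trig_poly f \<Longrightarrow> \<exists>B. \<forall>x. \<bar>f x\<bar> \<le> B"
proof (induction rule: trig_poly.induct)
  case (wave a t s)
  show ?case
    by (intro exI[of _ "\<bar>a\<bar>"]) (auto simp: abs_mult intro!: mult_left_le)
next
  case (add f g)
  then obtain B C where "\<And>x. \<bar>f x\<bar> \<le> B" "\<And>x. \<bar>g x\<bar> \<le> C" by blast
  thus ?case by (intro exI[of _ "B + C"]) (meson abs_triangle_ineq add_mono order_trans)
qed

text \<open>
  Folds the whole space onto a cube, coordinate by coordinate. A polynomial approximation on
  the cube therefore becomes uniform over the whole space after composition with this map.
\<close>

definition fold_map :: "real \<Rightarrow> 'v::euclidean_space \<Rightarrow> 'v" where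
  "fold_map c x = (\<Sum>b\<in>Basis. sin (c * (x \<bullet> b)) *\<^sub>R b)"

lemma trig_poly_fold_map:
  assumes "real_polynomial_function p"
  shows "trig_poly (\<lambda>x. p (fold_map c x))"
  using assms
proof (induction p)
  case (linear f)
  interpret bounded_linear f by fact
  have "f (fold_map c x) = (\<Sum>b\<in>Basis. f b * cos ((c *\<^sub>R b) \<bullet> x + (- pi / 2)))" for x
    by (simp add: fold_map_def sum scaleR cos_diff inner_commute mult.commute)
  thus ?case
    by (simp only:) (intro trig_poly_sum trig_poly.wave finite_Basis)
next
  case (const c) show ?case by (rule trig_poly_const)
next
  case (add f g)
  show ?case by (rule trig_poly.add[OF add.IH])
next
  case (mult f g)
  show ?case by (rule trig_poly_mult[OF mult.IH])
qed

text \<open>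
  A continuous and bounded function that vanishes on \<open>[-R, R]\<close> and equals one beyond
  distance \<open>R + 1\<close>. Being continuous, its integrals are controlled by weak convergence, which indicators of tails
  are not.
\<close>

definition tail_ramp :: "real \<Rightarrow> real \<Rightarrow> real" where
  "tail_ramp R y = min 1 (max 0 (\<bar>y\<bar> - R))"

lemma tail_ramp_bounds: "0 \<le> tail_ramp R y" "tail_ramp R y \<le> 1"
  by (auto simp: tail_ramp_def)

lemma tail_ramp_continuous: "continuous_on UNIV (tail_ramp R)"
  unfolding tail_ramp_def[abs_def] by (intro continuous_intros)

text \<open>
  A trigonometric polynomial cannot in general be uniformly close to \<open>f\<close> on the whole space; the error outside a
  cube is absorbed by the tail term. The function \<open>x \<mapsto> f (arcsin (sin (c x)) / c)\<close>, read
  coordinate by coordinate, agrees with \<open>f\<close> as long as \<open>|c x| \<le> pi / 2\<close> and is bounded by \<open>B\<close>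
  everywhere. It is a continuous function of \<open>fold_map c x\<close>, hence by the Stone-Weierstrass theorem
  uniformly close to a polynomial in \<open>fold_map c x\<close>.
\<close>

lemma trig_poly_approx:
  fixes f :: "'v::euclidean_space \<Rightarrow> real"
  assumes f: "continuous_on UNIV f" and B: "\<And>x. \<bar>f x\<bar> \<le> B" and "R > 0" "\<delta> > 0"
  obtains g where "trig_poly g"
    "\<And>x. \<bar>f x - g x\<bar> \<le> \<delta> + 2 * B * (\<Sum>b\<in>Basis. tail_ramp R (x \<bullet> b))"
proof -
  have B0: "B \<ge> 0" using B[of 0] by linarith
  \<comment> \<open>the cube of half-width \<open>R + 1\<close> is scaled to the one of half-width \<open>pi / 2\<close>, where \<open>arcsin\<close> inverts \<open>sin\<close>\<close>
  define c where "c = pi / 2 / (R + 1)"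
  have c0: "c > 0" and c1: "c * (R + 1) = pi / 2" using \<open>R > 0\<close> by (simp_all add: c_def field_simps)
  define F where "F v = f (\<Sum>b\<in>Basis. (arcsin (v \<bullet> b) / c) *\<^sub>R b)" for v :: 'v
  let ?S = "cbox (-One) One :: 'v set"
  have "continuous_on ?S F"
    unfolding F_def
    by (intro continuous_intros continuous_on_compose2[OF f]) (use c0 in \<open>auto simp: mem_box\<close>)
  then obtain p where p: "real_polynomial_function p" "\<And>v. v \<in> ?S \<Longrightarrow> \<bar>F v - p v\<bar> < \<delta>"
    using Stone_Weierstrass_real_polynomial_function[of ?S F \<delta>] \<open>\<delta> > 0\<close> by (metis compact_cbox)
  have fold: "fold_map c x \<in> ?S" for x
    by (auto simp: fold_map_def mem_box)
  have F_fold: "F (fold_map c x) = f (\<Sum>b\<in>Basis. (arcsin (sin (c * (x \<bullet> b))) / c) *\<^sub>R b)" for x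
    by (simp add: F_def fold_map_def)
  have main: "\<bar>f x - F (fold_map c x)\<bar> \<le> 2 * B * (\<Sum>b\<in>Basis. tail_ramp R (x \<bullet> b))" for x
  proof (cases "\<forall>b\<in>Basis. \<bar>x \<bullet> b\<bar> \<le> R + 1")
    case True
    have "(\<Sum>b\<in>Basis. (arcsin (sin (c * (x \<bullet> b))) / c) *\<^sub>R b) = (\<Sum>b\<in>Basis. (x \<bullet> b) *\<^sub>R b)"
    proof (intro sum.cong refl)
      fix b :: 'v assume "b \<in> Basis"
      hence "\<bar>c * (x \<bullet> b)\<bar> \<le> c * (R + 1)" using True c0 by (simp add: abs_mult)
      hence "arcsin (sin (c * (x \<bullet> b))) = c * (x \<bullet> b)"
        unfolding c1 by (intro arcsin_sin) auto
      thus "(arcsin (sin (c * (x \<bullet> b))) / c) *\<^sub>R b = (x \<bullet> b) *\<^sub>R b" using c0 by simp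
    qed
    also have "\<dots> = x" by (rule euclidean_representation)
    finally show ?thesis
      using B0 by (simp add: F_fold sum_nonneg tail_ramp_bounds)
  next
    case False
    then obtain b where b: "b \<in> Basis" "\<bar>x \<bullet> b\<bar> > R + 1" by force
    have "1 = tail_ramp R (x \<bullet> b)" using b by (simp add: tail_ramp_def)
    also have "\<dots> \<le> (\<Sum>b\<in>Basis. tail_ramp R (x \<bullet> b))"
      using b by (intro member_le_sum) (auto simp: tail_ramp_bounds)
    finally have "2 * B * 1 \<le> 2 * B * (\<Sum>b\<in>Basis. tail_ramp R (x \<bullet> b))"
      using B0 by (intro mult_left_mono) auto
    moreover have "\<bar>F (fold_map c x)\<bar> \<le> B"
      unfolding F_def by (rule B)
    ultimately show ?thesis using B[of x] by linarith
  qed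
  show ?thesis
  proof (rule that[of "\<lambda>x. p (fold_map c x)"])
    show "trig_poly (\<lambda>x. p (fold_map c x))" using p(1) by (rule trig_poly_fold_map)
    show "\<bar>f x - p (fold_map c x)\<bar> \<le> \<delta> + 2 * B * (\<Sum>b\<in>Basis. tail_ramp R (x \<bullet> b))" for x
      using main[of x] p(2)[OF fold[of x]] by linarith
  qed
qed

lemma integrable_bounded_continuous:
  fixes f :: "'v::euclidean_space \<Rightarrow> real"
  assumes "prob_space \<mu>" "sets \<mu> = sets borel" "continuous_on UNIV f" "\<And>x. \<bar>f x\<bar> \<le> B"
  shows "integrable \<mu> f"
proof -
  interpret prob_space \<mu> by fact
  have "f \<in> borel_measurable \<mu>"
    using borel_measurable_continuous_onI[OF assms(3)] assms(2) by (simp cong: measurable_cong_sets)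
  thus ?thesis using assms(4) by (intro integrable_const_bound[where B=B]) auto
qed

text \<open>
  Integrals of trigonometric polynomials converge because each wave sees one projection only. The
  approximation error for a general bounded continuous \<open>f\<close> is, up to an arbitrarily small constant, a
  multiple of the sum of the tail ramps of the coordinates. Their
  integrals converge too, again because coordinates are projections, and their limits are small for a
  large radius; this replaces a separate proof of tightness.
\<close>

theorem cramer_wold:
  fixes \<mu> :: "nat \<Rightarrow> 'v::euclidean_space measure"
  assumes \<mu>: "\<And>n. prob_space (\<mu> n)" "\<And>n. sets (\<mu> n) = sets borel"
    and \<nu>: "prob_space \<nu>" "sets \<nu> = sets borel"
    and proj: "\<And>t. weak_conv_m (\<lambda>n. distr (\<mu> n) borel (\<lambda>x. t \<bullet> x)) (distr \<nu> borel (\<lambda>x. t \<bullet> x))"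
  shows "weak_conv_gen \<mu> \<nu>"
proof -
  have meas: "(\<lambda>x. t \<bullet> x) \<in> borel_measurable M" if "sets M = sets borel" for M and t :: 'v
    using that by (simp cong: measurable_cong_sets)
  have rd: "real_distribution (distr M borel (\<lambda>x. t \<bullet> x))"
    if "prob_space M" "sets M = sets borel" for M and t :: 'v
    using prob_space.real_distribution_distr[OF that(1) meas[OF that(2)]] .
  have conv1: "(\<lambda>n. \<integral>x. h (t \<bullet> x) \<partial>\<mu> n) \<longlonglongrightarrow> (\<integral>x. h (t \<bullet> x) \<partial>\<nu>)"
    if h: "continuous_on UNIV h" "\<And>y. \<bar>h y\<bar> \<le> B" for h :: "real \<Rightarrow> real" and t B
  proof -
    have "(\<lambda>n. \<integral>y. h y \<partial>distr (\<mu> n) borel (\<lambda>x. t \<bullet> x)) \<longlonglongrightarrow> (\<integral>y. h y \<partial>distr \<nu> borel (\<lambda>x. t \<bullet> x))"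
      using h(2) by (intro weak_conv_imp_integral_bdd_continuous_conv[OF rd[OF \<mu>] rd[OF \<nu>] proj])
        (use h(1) in \<open>auto simp: continuous_on_eq_continuous_at\<close>)
    thus ?thesis
      using borel_measurable_continuous_onI[OF h(1)] meas \<mu> \<nu> by (simp add: integral_distr)
  qed
  note int = integrable_bounded_continuous
  have conv_trig: "(\<lambda>n. integral\<^sup>L (\<mu> n) g) \<longlonglongrightarrow> integral\<^sup>L \<nu> g" if "trig_poly g" for g
    using that
  proof (induction g)
    case (wave a t s)
    show ?case
      by (rule conv1[of "\<lambda>y. a * cos (y + s)" "\<bar>a\<bar>"])
        (auto intro!: continuous_intros mult_left_le simp: abs_mult)
  next
    case (add f g)
    obtain B C where "\<And>x. \<bar>f x\<bar> \<le> B" "\<And>x. \<bar>g x\<bar> \<le> C"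
      using add.hyps trig_poly_bounded by metis
    moreover have "continuous_on UNIV f" "continuous_on UNIV g"
      using add.hyps trig_poly_continuous by auto
    ultimately have "integrable M f" "integrable M g" if "prob_space M" "sets M = sets borel" for M
      using that int by blast+
    thus ?case using \<mu> \<nu> tendsto_add[OF add.IH] by simp
  qed
  show ?thesis
    unfolding weak_conv_gen_def
  proof (intro allI impI)
    fix f :: "'v \<Rightarrow> real" assume f: "continuous_on UNIV f" "bounded (range f)"
    then obtain B where B: "\<And>x. \<bar>f x\<bar> \<le> B" by (auto simp: bounded_iff)
    have B0: "B \<ge> 0" using B[of 0] by linarith
    have "(\<lambda>n. integral\<^sup>L (\<mu> n) f - integral\<^sup>L \<nu> f) \<longlonglongrightarrow> 0"
    proof (rule LIMSEQ_I)
      fix e :: real assume e: "e > 0"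
      \<comment> \<open>the error budget for one coordinate tail; the factor \<open>B + 1\<close> avoids a division by zero\<close>
      define \<epsilon> where "\<epsilon> = e / 16 / ((B + 1) * DIM('v))"
      have \<epsilon>0: "\<epsilon> > 0" using e B0 by (simp add: \<epsilon>_def)
      have "(\<lambda>k. \<integral>x. tail_ramp (real k) (x \<bullet> b) \<partial>\<nu>) \<longlonglongrightarrow> (\<integral>x. 0 \<partial>\<nu>)" if "b \<in> Basis" for b :: 'v
      proof (rule integral_dominated_convergence[where w="\<lambda>_. 1"])
        show "integrable \<nu> (\<lambda>_. 1::real)"
          by (intro int[where B = 1] \<nu>) auto
        show "AE x in \<nu>. (\<lambda>k. tail_ramp (real k) (x \<bullet> b)) \<longlonglongrightarrow> 0"
        proof (intro AE_I2 tendsto_eventually)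
          fix x
          show "\<forall>\<^sub>F k in sequentially. tail_ramp (real k) (x \<bullet> b) = 0"
            using eventually_ge_at_top[of "nat \<lceil>\<bar>x \<bullet> b\<bar>\<rceil>"]
            by eventually_elim (simp add: tail_ramp_def max_def nat_le_iff ceiling_le_iff)
        qed
        show "AE x in \<nu>. norm (tail_ramp (real k) (x \<bullet> b)) \<le> 1" for k
          using tail_ramp_bounds by simp
        show "(\<lambda>x. tail_ramp (real k) (x \<bullet> b)) \<in> borel_measurable \<nu>" for k
        proof -
          have "continuous_on UNIV (\<lambda>x. tail_ramp (real k) (x \<bullet> b))"
            by (intro continuous_on_compose2[OF tail_ramp_continuous] continuous_intros) auto
          from borel_measurable_continuous_onI[OF this] show ?thesis
            using \<nu>(2) by (simp cong: measurable_cong_sets)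
        qed
      qed simp
      hence "\<forall>b\<in>Basis. \<forall>\<^sub>F k in sequentially. (\<integral>x. tail_ramp (real k) (x \<bullet> b) \<partial>\<nu>) < \<epsilon>"
        by (intro ballI order_tendstoD(2)[OF _ \<epsilon>0]) simp
      hence "\<forall>\<^sub>F k in sequentially. \<forall>b\<in>Basis. (\<integral>x. tail_ramp (real k) (x \<bullet> b) \<partial>\<nu>) < \<epsilon>"
        by (intro eventually_ball_finite) auto
      hence "\<forall>\<^sub>F k in sequentially. (\<forall>b\<in>Basis. (\<integral>x. tail_ramp (real k) (x \<bullet> b) \<partial>\<nu>) < \<epsilon>) \<and> k > 0"
        using eventually_gt_at_top[of 0] by eventually_elim auto
      then obtain k where k: "\<And>b. b \<in> Basis \<Longrightarrow> (\<integral>x. tail_ramp (real k) (x \<bullet> b) \<partial>\<nu>) < \<epsilon>" "k > 0"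
        by (auto simp: eventually_sequentially)
      define h where "h = (\<lambda>x::'v. \<Sum>b\<in>Basis. tail_ramp (real k) (b \<bullet> x))"
      have cont: "continuous_on UNIV (\<lambda>x::'v. tail_ramp (real k) (b \<bullet> x))" for b
        by (intro continuous_on_compose2[OF tail_ramp_continuous] continuous_intros) auto
      have int_ramp: "integrable M (\<lambda>x::'v. tail_ramp (real k) (b \<bullet> x))"
        if "prob_space M" "sets M = sets borel" for M b
        using that by (intro int[where B = 1] cont) (auto simp: tail_ramp_bounds)
      have int_h: "integrable M h" if "prob_space M" "sets M = sets borel" for M
        unfolding h_def using int_ramp[OF that] by auto
      have h_lim: "(\<lambda>n. integral\<^sup>L (\<mu> n) h) \<longlonglongrightarrow> integral\<^sup>L \<nu> h"
        unfolding h_def using int_ramp[OF \<mu>] int_ramp[OF \<nu>]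
        by (simp add: tail_ramp_bounds tail_ramp_continuous, intro tendsto_sum conv1[where B = 1])
          (auto simp: tail_ramp_bounds tail_ramp_continuous)
      have h_small: "integral\<^sup>L \<nu> h \<le> DIM('v) * \<epsilon>"
        unfolding h_def using int_ramp[OF \<nu>]
        by (simp, intro sum_bounded_above) (use k in \<open>auto simp: inner_commute intro: less_imp_le\<close>)
      obtain g where g: "trig_poly g"
        "\<And>x. \<bar>f x - g x\<bar> \<le> e / 16 + 2 * B * (\<Sum>b\<in>Basis. tail_ramp (real k) (x \<bullet> b))"
        using trig_poly_approx[OF f(1) B, of "real k" "e / 16"] k(2) e by auto
      obtain C where C: "\<And>x. \<bar>g x\<bar> \<le> C" using trig_poly_bounded[OF g(1)] by blast
      have cmp: "\<bar>integral\<^sup>L M f - integral\<^sup>L M g\<bar> \<le> e / 16 + 2 * B * integral\<^sup>L M h"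
        if M: "prob_space M" "sets M = sets borel" for M
      proof -
        interpret prob_space M by fact
        have i: "integrable M f" "integrable M g"
          using int[OF M f(1) B] int[OF M trig_poly_continuous[OF g(1)] C] .
        hence "\<bar>integral\<^sup>L M f - integral\<^sup>L M g\<bar> = \<bar>\<integral>x. f x - g x \<partial>M\<bar>" by simp
        also have "\<dots> \<le> (\<integral>x. \<bar>f x - g x\<bar> \<partial>M)" by (rule integral_abs_bound)
        also have "\<dots> \<le> (\<integral>x. e / 16 + 2 * B * h x \<partial>M)"
          using g(2) i int_h[OF M] by (intro integral_mono) (auto simp: h_def inner_commute)
        also have "\<dots> = e / 16 + 2 * B * integral\<^sup>L M h"
          using int_h[OF M] by (simp add: prob_space)
        finally show ?thesis .
      qed
      have "2 * B * (DIM('v) * \<epsilon>) \<le> e / 8"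
      proof -
        have "2 * B * (DIM('v) * \<epsilon>) = (e / 8) * (B / (B + 1))"
          using B0 unfolding \<epsilon>_def by (simp add: divide_simps)
        also have "\<dots> \<le> (e / 8) * 1" using e B0 by (intro mult_left_mono) auto
        finally show ?thesis by simp
      qed
      hence Bh: "2 * B * integral\<^sup>L \<nu> h \<le> e / 8"
        using h_small B0 by (meson mult_left_mono mult_nonneg_nonneg order_trans zero_le_numeral)
      have "(\<lambda>n. 2 * B * integral\<^sup>L (\<mu> n) h) \<longlonglongrightarrow> 2 * B * integral\<^sup>L \<nu> h"
        by (intro tendsto_intros h_lim)
      hence "\<forall>\<^sub>F n in sequentially. 2 * B * integral\<^sup>L (\<mu> n) h < e / 4"
        using Bh e by (intro order_tendstoD(2)[where a = "e/4"]) auto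
      moreover have "\<forall>\<^sub>F n in sequentially. dist (integral\<^sup>L (\<mu> n) g) (integral\<^sup>L \<nu> g) < e / 8"
        using conv_trig[OF g(1)] e by (intro tendstoD) auto
      ultimately have "\<forall>\<^sub>F n in sequentially. norm (integral\<^sup>L (\<mu> n) f - integral\<^sup>L \<nu> f - 0) < e"
      proof eventually_elim
        case (elim n)
        have "\<bar>integral\<^sup>L (\<mu> n) f - integral\<^sup>L \<nu> f\<bar> < e"
          using elim cmp[OF \<mu>, of n] cmp[OF \<nu>] Bh e unfolding dist_real_def by arith
        thus ?case by simp
      qed
      thus "\<exists>no. \<forall>n\<ge>no. norm (integral\<^sup>L (\<mu> n) f - integral\<^sup>L \<nu> f - 0) < e"
        by (simp add: eventually_sequentially)
    qed
    thus "(\<lambda>n. integral\<^sup>L (\<mu> n) f) \<longlonglongrightarrow> integral\<^sup>L \<nu> f" by (simp add: LIM_zero_iff)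
  qed
qed

section \<open>The central limit theorem for weighted sums\<close>

lemma real_distribution_normal_law: "real_distribution (normal_law m v)"
  unfolding normal_law_def
  by (rule prob_space.real_distribution_distr)
    (auto intro: real_distribution.axioms(1) real_dist_normal_dist)

lemma char_normal_law:
  "v \<ge> 0 \<Longrightarrow> char (normal_law 0 v) t = exp (- (v * t\<^sup>2) / 2)"
proof -
  have [measurable]: "(\<lambda>z. m + sqrt v * z) \<in> borel_measurable std_normal_distribution" for m by simp
  interpret real_distribution std_normal_distribution by (rule real_dist_normal_dist)
  assume v: "v \<ge> 0"
  have "char (normal_law 0 v) t = (\<integral>z. iexp (t * (0 + sqrt v * z)) \<partial>std_normal_distribution)"
    unfolding char_def normal_law_def by (subst integral_distr) auto
  also have "\<dots> = char std_normal_distribution (sqrt v * t)"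
    by (simp add: char_def mult_ac)
  also have "\<dots> = exp (- (v * t\<^sup>2) / 2)"
    using v by (simp add: char_std_normal_distribution power_mult_distrib)
  finally show "char (normal_law 0 v) t = exp (- (v * t\<^sup>2) / 2)" .
qed

text \<open>
  The characteristic function of \<open>X\<close> and the Gaussian one have the same second order expansion
  \<open>1 - v u\<^sup>2 / 2\<close> at zero. The remainder is \<open>o(u\<^sup>2)\<close>, without any third moment of \<open>X\<close>: dominated
  convergence shows that the truncated third moment \<open>G u\<close> below tends to zero with \<open>u\<close>.
\<close>

lemma (in prob_space) char_near_gaussian:
  fixes X :: "'a \<Rightarrow> real"
  assumes X[measurable]: "random_variable borel X" and int: "integrable M X" "integrable M (\<lambda>\<omega>. (X \<omega>)\<^sup>2)"
    and mom: "expectation X = 0" "expectation (\<lambda>\<omega>. (X \<omega>)\<^sup>2) = v" and "\<eta> > 0"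
  shows "\<exists>\<delta>>0. \<forall>u. \<bar>u\<bar> \<le> \<delta> \<longrightarrow> norm (char (distr M borel X) u - complex_of_real (exp (- (v * u\<^sup>2) / 2))) \<le> \<eta> * u\<^sup>2"
proof -
  have v0: "v \<ge> 0" unfolding mom(2)[symmetric] by simp
  define G where "G u = expectation (\<lambda>\<omega>. min (6 * (X \<omega>)\<^sup>2) (\<bar>u\<bar> * \<bar>X \<omega>\<bar> ^ 3))" for u
  have "(\<lambda>k. G (1 / real (Suc k))) \<longlonglongrightarrow> expectation (\<lambda>\<omega>. 0)"
    unfolding G_def
  proof (rule integral_dominated_convergence[where w = "\<lambda>\<omega>. 6 * (X \<omega>)\<^sup>2"])
    show "AE \<omega> in M. (\<lambda>k. min (6 * (X \<omega>)\<^sup>2) (\<bar>1 / real (Suc k)\<bar> * \<bar>X \<omega>\<bar> ^ 3)) \<longlonglongrightarrow> 0"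
    proof (intro AE_I2)
      fix \<omega>
      have "(\<lambda>k. min (6 * (X \<omega>)\<^sup>2) (\<bar>1 / real (Suc k)\<bar> * \<bar>X \<omega>\<bar> ^ 3)) \<longlonglongrightarrow> min (6 * (X \<omega>)\<^sup>2) (\<bar>0\<bar> * \<bar>X \<omega>\<bar> ^ 3)"
        using LIMSEQ_inverse_real_of_nat by (intro tendsto_intros) (simp add: inverse_eq_divide)
      thus "(\<lambda>k. min (6 * (X \<omega>)\<^sup>2) (\<bar>1 / real (Suc k)\<bar> * \<bar>X \<omega>\<bar> ^ 3)) \<longlonglongrightarrow> 0" by simp
    qed
  qed (use int in auto)
  hence "\<forall>\<^sub>F k in sequentially. G (1 / real (Suc k)) < 3 * \<eta>"
    using \<open>\<eta> > 0\<close> by (intro order_tendstoD(2)[where a = "3 * \<eta>"]) auto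
  then obtain k where k: "G (1 / real (Suc k)) < 3 * \<eta>" by (auto simp: eventually_sequentially)
  have G_mono: "G u \<le> G w" if "\<bar>u\<bar> \<le> \<bar>w\<bar>" for u w
    unfolding G_def
  proof (rule integral_mono)
    have "integrable M (\<lambda>\<omega>. min (6 * (X \<omega>)\<^sup>2) (\<bar>u\<bar> * \<bar>X \<omega>\<bar> ^ 3))" for u
      by (rule Bochner_Integration.integrable_bound[where f = "\<lambda>\<omega>. 6 * (X \<omega>)\<^sup>2"]) (use int in auto)
    thus "integrable M (\<lambda>\<omega>. min (6 * (X \<omega>)\<^sup>2) (\<bar>u\<bar> * \<bar>X \<omega>\<bar> ^ 3))"
      "integrable M (\<lambda>\<omega>. min (6 * (X \<omega>)\<^sup>2) (\<bar>w\<bar> * \<bar>X \<omega>\<bar> ^ 3))" by auto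
    show "min (6 * (X \<omega>)\<^sup>2) (\<bar>u\<bar> * \<bar>X \<omega>\<bar> ^ 3) \<le> min (6 * (X \<omega>)\<^sup>2) (\<bar>w\<bar> * \<bar>X \<omega>\<bar> ^ 3)" for \<omega>
      using that by (intro min.mono mult_right_mono) auto
  qed
  \<comment> \<open>the first bound controls the remainder for \<open>X\<close>, the second the quadratic term of the exponential\<close>
  define \<delta> where "\<delta> = min (1 / real (Suc k)) (sqrt (2 * \<eta> / (v\<^sup>2 + 1)))"
  have "\<delta> > 0" using \<open>\<eta> > 0\<close> by (simp add: \<delta>_def add_nonneg_pos)
  moreover have "norm (char (distr M borel X) u - complex_of_real (exp (- (v * u\<^sup>2) / 2))) \<le> \<eta> * u\<^sup>2" if u: "\<bar>u\<bar> \<le> \<delta>" for u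
  proof -
    have "norm (char (distr M borel X) u - (1 - u\<^sup>2 * v / 2)) \<le> u\<^sup>2 / 6 * G u"
      unfolding G_def by (rule char_approx3') (use int mom in auto)
    also have "\<dots> \<le> u\<^sup>2 / 6 * (3 * \<eta>)"
      using G_mono[of u "1 / real (Suc k)"] k u by (intro mult_left_mono) (auto simp: \<delta>_def)
    finally have 1: "norm (char (distr M borel X) u - (1 - u\<^sup>2 * v / 2)) \<le> \<eta> / 2 * u\<^sup>2" by (simp add: mult_ac)
    define z where "z = v * u\<^sup>2 / 2"
    have z: "z \<ge> 0" using v0 by (simp add: z_def)
    have "\<bar>exp (- z) - (1 - z)\<bar> \<le> z\<^sup>2"
    proof -
      have "exp (- z) \<ge> 1 + (- z)" by (rule exp_ge_add_one_self)
      moreover have "exp (- z) \<le> 1 / (1 + z)"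
        using exp_ge_add_one_self[of z] z by (simp add: exp_minus' frac_le)
      moreover have "1 / (1 + z) \<le> 1 - z + z\<^sup>2"
      proof -
        have "(1 - z + z\<^sup>2) * (1 + z) = 1 + z ^ 3"
          by (simp add: algebra_simps power2_eq_square power3_eq_cube)
        moreover have "1 + z ^ 3 \<ge> 1" using z by simp
        ultimately have "1 \<le> (1 - z + z\<^sup>2) * (1 + z)" by (simp only:)
        thus ?thesis using z by (subst pos_divide_le_eq) auto
      qed
      ultimately show ?thesis by simp
    qed
    also have "z\<^sup>2 = v\<^sup>2 * u\<^sup>2 / 4 * u\<^sup>2" by (simp add: z_def power2_eq_square)
    also have "\<dots> \<le> \<eta> / 2 * u\<^sup>2"
    proof (intro mult_right_mono)
      have "u\<^sup>2 \<le> \<delta>\<^sup>2" using u \<open>\<delta> > 0\<close> by (intro abs_le_square_iff[THEN iffD1]) auto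
      also have "\<delta>\<^sup>2 \<le> (sqrt (2 * \<eta> / (v\<^sup>2 + 1)))\<^sup>2"
        using \<open>\<delta> > 0\<close> by (intro power_mono) (auto simp: \<delta>_def)
      also have "\<dots> = 2 * \<eta> / (v\<^sup>2 + 1)" using \<open>\<eta> > 0\<close> by (simp add: add_nonneg_pos)
      finally have "v\<^sup>2 * u\<^sup>2 \<le> v\<^sup>2 * (2 * \<eta> / (v\<^sup>2 + 1))" by (intro mult_left_mono) auto
      also have "\<dots> \<le> 2 * \<eta>" 
      proof -
        have "v\<^sup>2 * (2 * \<eta> / (v\<^sup>2 + 1)) = (v\<^sup>2 / (v\<^sup>2 + 1)) * (2 * \<eta>)" by simp
        also have "\<dots> \<le> 1 * (2 * \<eta>)"
          using \<open>\<eta> > 0\<close> by (intro mult_right_mono) (simp_all add: divide_le_eq add_nonneg_pos)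
        finally show ?thesis by simp
      qed
      finally show "v\<^sup>2 * u\<^sup>2 / 4 \<le> \<eta> / 2" by linarith
    qed simp
    finally have "norm (complex_of_real (exp (- z) - (1 - z))) \<le> \<eta> / 2 * u\<^sup>2" by (simp only: norm_of_real)
    hence 2: "norm ((1 - u\<^sup>2 * v / 2) - complex_of_real (exp (- z))) \<le> \<eta> / 2 * u\<^sup>2"
      by (simp add: z_def norm_minus_commute mult_ac)
    have "norm (char (distr M borel X) u - complex_of_real (exp (- z))) \<le> \<eta> / 2 * u\<^sup>2 + \<eta> / 2 * u\<^sup>2"
      by (rule norm_diff_triangle_le[OF 1 2])
    thus ?thesis by (simp add: z_def algebra_simps)
  qed
  ultimately show ?thesis by blast
qed

text \<open>
  A Lindeberg type theorem for triangular arrays. For fixed \<open>t\<close>, the difference of two products of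
  numbers in the unit disc is at most the sum of the differences of their factors, and by
  \<open>char_near_gaussian\<close> each of these is at most \<open>\<eta> * (t * a n k)\<^sup>2\<close> once all weights are small. Since
  the squared weights have a bounded sum, the total is a multiple of \<open>\<eta>\<close>; and the product of
  the Gaussian factors depends on the weights through the sum of their squares only.
\<close>

theorem (in prob_space) weighted_sum_clt:
  fixes X :: "'i \<Rightarrow> 'a \<Rightarrow> real"
  assumes indep: "indep_vars (\<lambda>_. borel) X I"
    and ident: "\<And>k k'. k \<in> I \<Longrightarrow> k' \<in> I \<Longrightarrow> distr M borel (X k) = distr M borel (X k')"
    and mean: "\<And>k. k \<in> I \<Longrightarrow> integrable M (X k) \<and> expectation (X k) = 0"
    and var: "\<And>k. k \<in> I \<Longrightarrow> integrable M (\<lambda>\<omega>. (X k \<omega>)\<^sup>2) \<and> expectation (\<lambda>\<omega>. (X k \<omega>)\<^sup>2) = \<sigma>\<^sup>2"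
    and K: "\<And>n. K n \<subseteq> I" "\<And>n. finite (K n)"
    and sq: "(\<lambda>n. \<Sum>k\<in>K n. (a n k)\<^sup>2) \<longlonglongrightarrow> s"
    and small: "\<And>\<delta>. \<delta> > 0 \<Longrightarrow> \<forall>\<^sub>F n in sequentially. \<forall>k\<in>K n. \<bar>a n k\<bar> \<le> \<delta>"
  shows "weak_conv_m (\<lambda>n. distr M borel (\<lambda>\<omega>. \<Sum>k\<in>K n. a n k * X k \<omega>)) (normal_law 0 (\<sigma>\<^sup>2 * s))"
proof (rule levy_continuity)
  have rv[measurable]: "random_variable borel (X k)" if "k \<in> I" for k
    using indep that unfolding indep_vars_def2 by blast
  have rv': "random_variable borel (X k)" if "k \<in> K n" for k n using K(1) that rv by blast
  show "real_distribution (distr M borel (\<lambda>\<omega>. \<Sum>k\<in>K n. a n k * X k \<omega>))" for n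
    by (intro real_distribution_distr borel_measurable_sum borel_measurable_times rv') auto
  show "real_distribution (normal_law 0 (\<sigma>\<^sup>2 * s))" by (rule real_distribution_normal_law)
  have s0: "s \<ge> 0" by (rule tendsto_lowerbound[OF sq]) (auto intro!: sum_nonneg always_eventually)
  fix t
  define \<phi> where "\<phi> k = char (distr M borel (X k))" for k
  have char_sum: "char (distr M borel (\<lambda>\<omega>. \<Sum>k\<in>K n. a n k * X k \<omega>)) t = (\<Prod>k\<in>K n. \<phi> k (t * a n k))" for n
  proof -
    have "indep_vars (\<lambda>_. borel) (\<lambda>k \<omega>. a n k * X k \<omega>) (K n)"
      by (rule indep_vars_compose2[OF indep_vars_subset[OF indep K(1)]]) simp
    from char_distr_sum[OF this] show ?thesis
      using rv'[of _ n] by (auto simp: \<phi>_def char_def integral_distr mult_ac intro!: prod.cong)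
  qed
  have near: "\<exists>\<delta>>0. \<forall>k\<in>I. \<forall>u. \<bar>u\<bar> \<le> \<delta> \<longrightarrow> norm (\<phi> k u - complex_of_real (exp (- (\<sigma>\<^sup>2 * u\<^sup>2) / 2))) \<le> \<eta> * u\<^sup>2"
    if "\<eta> > 0" for \<eta>
  proof (cases "I = {}")
    case False
    then obtain k0 where k0: "k0 \<in> I" by auto
    have same: "\<phi> k = \<phi> k0" if "k \<in> I" for k unfolding \<phi>_def ident[OF that k0] ..
    have "\<exists>\<delta>>0. \<forall>u. \<bar>u\<bar> \<le> \<delta> \<longrightarrow> norm (\<phi> k0 u - complex_of_real (exp (- (\<sigma>\<^sup>2 * u\<^sup>2) / 2))) \<le> \<eta> * u\<^sup>2"
      unfolding \<phi>_def using rv[OF k0] mean[OF k0] var[OF k0] that by (intro char_near_gaussian) auto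
    thus ?thesis using same by metis
  qed (auto intro: exI[of _ 1])
  have "(\<lambda>n. (\<Prod>k\<in>K n. \<phi> k (t * a n k)) - (\<Prod>k\<in>K n. complex_of_real (exp (- (\<sigma>\<^sup>2 * (t * a n k)\<^sup>2) / 2)))) \<longlonglongrightarrow> 0"
  proof (rule LIMSEQ_I)
    fix e :: real assume e: "e > 0"
    \<comment> \<open>\<open>s + 1\<close> eventually bounds the sum of squares; the last summand keeps the denominator positive\<close>
    define \<eta> where "\<eta> = e / 2 / (t\<^sup>2 * (s + 1) + 1)"
    have D: "t\<^sup>2 * (s + 1) + 1 > 0" using s0 by (intro add_nonneg_pos) auto
    have \<eta>: "\<eta> > 0" using e D by (simp add: \<eta>_def)
    from near[OF \<eta>] obtain \<delta> where \<delta>: "\<delta> > 0"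
      "\<And>k u. k \<in> I \<Longrightarrow> \<bar>u\<bar> \<le> \<delta> \<Longrightarrow> norm (\<phi> k u - complex_of_real (exp (- (\<sigma>\<^sup>2 * u\<^sup>2) / 2))) \<le> \<eta> * u\<^sup>2" by blast
    have "\<forall>\<^sub>F n in sequentially. \<forall>k\<in>K n. \<bar>a n k\<bar> \<le> \<delta> / (\<bar>t\<bar> + 1)"
      using \<delta>(1) by (intro small) (auto intro!: divide_pos_pos)
    moreover have "\<forall>\<^sub>F n in sequentially. (\<Sum>k\<in>K n. (a n k)\<^sup>2) < s + 1"
      using sq by (rule order_tendstoD) simp
    ultimately have "\<forall>\<^sub>F n in sequentially. norm ((\<Prod>k\<in>K n. \<phi> k (t * a n k))
        - (\<Prod>k\<in>K n. complex_of_real (exp (- (\<sigma>\<^sup>2 * (t * a n k)\<^sup>2) / 2))) - 0) < e"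
    proof eventually_elim
      case (elim n)
      have ta: "\<bar>t * a n k\<bar> \<le> \<delta>" if "k \<in> K n" for k
      proof -
        have "\<bar>t * a n k\<bar> \<le> (\<bar>t\<bar> + 1) * (\<delta> / (\<bar>t\<bar> + 1))"
          unfolding abs_mult using elim(1) that by (intro mult_mono) auto
        thus ?thesis by simp
      qed
      have "norm ((\<Prod>k\<in>K n. \<phi> k (t * a n k)) - (\<Prod>k\<in>K n. complex_of_real (exp (- (\<sigma>\<^sup>2 * (t * a n k)\<^sup>2) / 2))))
          \<le> (\<Sum>k\<in>K n. norm (\<phi> k (t * a n k) - complex_of_real (exp (- (\<sigma>\<^sup>2 * (t * a n k)\<^sup>2) / 2))))"
      proof (rule norm_prod_diff)
        show "norm (\<phi> k (t * a n k)) \<le> 1" if "k \<in> K n" for k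
          unfolding \<phi>_def using rv'[OF that]
          by (intro real_distribution.cmod_char_le_1 real_distribution_distr)
        show "norm (complex_of_real (exp (- (\<sigma>\<^sup>2 * (t * a n k)\<^sup>2) / 2))) \<le> 1" for k
          by (simp only: norm_of_real) simp
      qed
      also have "\<dots> \<le> (\<Sum>k\<in>K n. \<eta> * (t * a n k)\<^sup>2)"
        using K(1)[of n] ta by (intro sum_mono \<delta>(2)) auto
      also have "\<dots> = \<eta> * (t\<^sup>2 * (\<Sum>k\<in>K n. (a n k)\<^sup>2))"
        by (simp add: sum_distrib_left power_mult_distrib mult_ac)
      also have "\<dots> \<le> \<eta> * (t\<^sup>2 * (s + 1) + 1)"
      proof (rule mult_left_mono)
        have "t\<^sup>2 * (\<Sum>k\<in>K n. (a n k)\<^sup>2) \<le> t\<^sup>2 * (s + 1)" using elim(2) by (intro mult_left_mono) auto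
        thus "t\<^sup>2 * (\<Sum>k\<in>K n. (a n k)\<^sup>2) \<le> t\<^sup>2 * (s + 1) + 1" by simp
      qed (use \<eta> in simp)
      also have "\<dots> = e / 2"
        using D unfolding \<eta>_def by (metis less_irrefl nonzero_eq_divide_eq)
      finally show ?case using e by simp
    qed
    thus "\<exists>no. \<forall>n\<ge>no. norm ((\<Prod>k\<in>K n. \<phi> k (t * a n k))
        - (\<Prod>k\<in>K n. complex_of_real (exp (- (\<sigma>\<^sup>2 * (t * a n k)\<^sup>2) / 2))) - 0) < e"
      by (simp only: eventually_sequentially)
  qed
  moreover have "(\<lambda>n. \<Prod>k\<in>K n. complex_of_real (exp (- (\<sigma>\<^sup>2 * (t * a n k)\<^sup>2) / 2))) \<longlonglongrightarrow> char (normal_law 0 (\<sigma>\<^sup>2 * s)) t"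
  proof -
    have "(\<Prod>k\<in>K n. complex_of_real (exp (- (\<sigma>\<^sup>2 * (t * a n k)\<^sup>2) / 2)))
        = complex_of_real (exp (- (\<sigma>\<^sup>2 * (\<Sum>k\<in>K n. (a n k)\<^sup>2) * t\<^sup>2) / 2))" for n
    proof -
      have "(\<Sum>k\<in>K n. - (\<sigma>\<^sup>2 * (t * a n k)\<^sup>2) / 2) = - (\<sigma>\<^sup>2 * (\<Sum>k\<in>K n. (a n k)\<^sup>2) * t\<^sup>2) / 2"
        by (simp add: sum_distrib_left sum_distrib_right power_mult_distrib mult_ac sum_negf flip: sum_divide_distrib)
      thus ?thesis using K(2) by (simp only: flip: of_real_prod exp_sum)
    qed
    moreover have "(\<lambda>n. complex_of_real (exp (- (\<sigma>\<^sup>2 * (\<Sum>k\<in>K n. (a n k)\<^sup>2) * t\<^sup>2) / 2)))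
        \<longlonglongrightarrow> complex_of_real (exp (- (\<sigma>\<^sup>2 * s * t\<^sup>2) / 2))"
      by (intro tendsto_intros sq) auto
    ultimately show ?thesis using s0 by (simp add: char_normal_law)
  qed
  ultimately show "(\<lambda>n. char (distr M borel (\<lambda>\<omega>. \<Sum>k\<in>K n. a n k * X k \<omega>)) t) \<longlonglongrightarrow> char (normal_law 0 (\<sigma>\<^sup>2 * s)) t"
    unfolding char_sum by (rule Lim_transform[rotated])
qed

section \<open>The multivariate normal law\<close>

lemma symmetric_form:
  fixes S :: "real^'p^'p"
  assumes "transpose S = S"
  shows "(S *v u) \<bullet> v = u \<bullet> (S *v v)"
  by (metis assms dot_lmul_matrix vector_transpose_matrix)

lemma matrix_inv_mult_vec:
  fixes S :: "real^'p^'p"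
  assumes "invertible S"
  shows "matrix_inv S *v (S *v v) = v" "S *v (matrix_inv S *v v) = v"
proof -
  have "S ** matrix_inv S = mat 1 \<and> matrix_inv S ** S = mat 1"
    unfolding matrix_inv_def using assms unfolding invertible_def by (rule someI_ex)
  thus "matrix_inv S *v (S *v v) = v" "S *v (matrix_inv S *v v) = v"
    by (simp_all add: matrix_vector_mul_assoc)
qed

text \<open>
  Gram-Schmidt orthogonalisation with respect to the inner product \<open>u \<bullet> (S *v v)\<close>, adding one index at
  a time: fewer than \<open>CARD('p)\<close> vectors do not span the space, so there is a vector left to
  orthogonalise.
\<close>

lemma pos_def_orthonormal_family:
  fixes S :: "real^'p^'p"
  assumes S: "pos_def S"
  shows "\<exists>B :: 'p \<Rightarrow> real^'p. \<forall>i\<in>A. \<forall>j\<in>A. B i \<bullet> (S *v B j) = (if i = j then 1 else 0)"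
proof (induction A rule: finite_induct[OF finite])
  case 1 show ?case by simp
next
  case (2 k A)
  have sym: "u \<bullet> (S *v v) = v \<bullet> (S *v u)" for u v
    using symmetric_form[of S v u] S by (simp add: pos_def_def inner_commute)
  from 2 obtain B where B: "\<And>i j. i \<in> A \<Longrightarrow> j \<in> A \<Longrightarrow> B i \<bullet> (S *v B j) = (if i = j then 1 else 0)" by blast
  have "dim (B ` A) < DIM(real^'p)"
  proof -
    have "dim (B ` A) \<le> card (B ` A)" by (rule dim_le_card') simp
    also have "\<dots> \<le> card A" by (rule card_image_le) simp
    also have "\<dots> < card (UNIV :: 'p set)" using 2 by (intro psubset_card_mono) auto
    finally show ?thesis by simp
  qed
  then obtain v where v: "v \<notin> span (B ` A)"
    by (metis UNIV_eq_I dim_UNIV dim_span less_irrefl)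
  define w where "w = v - (\<Sum>i\<in>A. (B i \<bullet> (S *v v)) *\<^sub>R B i)"
  have "w \<noteq> 0"
  proof
    assume "w = 0"
    hence "v = (\<Sum>i\<in>A. (B i \<bullet> (S *v v)) *\<^sub>R B i)" by (simp add: w_def)
    also have "\<dots> \<in> span (B ` A)" by (intro span_sum span_scale span_base) auto
    finally show False using v by simp
  qed
  hence pos: "w \<bullet> (S *v w) > 0" using S by (simp add: pos_def_def)
  have orth: "B j \<bullet> (S *v w) = 0" if "j \<in> A" for j
  proof -
    have "B j \<bullet> (S *v w) = B j \<bullet> (S *v v) - (\<Sum>i\<in>A. (B i \<bullet> (S *v v)) * (B j \<bullet> (S *v B i)))"
      unfolding w_def
      by (simp add: matrix_vector_mult_diff_distrib inner_diff_right linear_sum[OF matrix_vector_mul_linear]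
          matrix_vector_mult_scaleR inner_sum_right)
    also have "(\<Sum>i\<in>A. (B i \<bullet> (S *v v)) * (B j \<bullet> (S *v B i))) = (\<Sum>i\<in>A. if i = j then B i \<bullet> (S *v v) else 0)"
      using B[OF that] by (intro sum.cong) auto
    also have "\<dots> = B j \<bullet> (S *v v)" using that by simp
    finally show ?thesis by simp
  qed
  define c where "c = 1 / sqrt (w \<bullet> (S *v w))"
  have c: "c * (c * (w \<bullet> (S *v w))) = 1" using pos by (simp add: c_def field_simps)
  show ?case
  proof (intro exI[of _ "B(k := c *\<^sub>R w)"] ballI)
    fix i j assume "i \<in> insert k A" "j \<in> insert k A"
    then consider "i = k" "j = k" | "i = k" "j \<in> A" "j \<noteq> k" | "i \<in> A" "i \<noteq> k" "j = k"
      | "i \<in> A" "i \<noteq> k" "j \<in> A" "j \<noteq> k" using 2(2) by blast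
    thus "(B(k := c *\<^sub>R w)) i \<bullet> (S *v (B(k := c *\<^sub>R w)) j) = (if i = j then 1 else 0)"
    proof cases
      case 1 thus ?thesis using c by (simp add: matrix_vector_mult_scaleR)
    next
      case 2
      have "w \<bullet> (S *v B j) = 0" using orth[OF 2(2)] by (subst sym)
      thus ?thesis using 2 by simp
    next
      case 3 thus ?thesis using orth[of i] by (simp add: matrix_vector_mult_scaleR)
    next
      case 4 thus ?thesis using B by simp
    qed
  qed
qed

text \<open>
  The columns of \<open>B\<close> form a basis that is orthonormal for \<open>S\<close>, that is \<open>B' S B = 1\<close>; hence \<open>S\<^sup>-\<^sup>1 = B B'\<close>. Such a
  factorisation is what gives the choice of a square root in \<open>mv_normal\<close> its meaning.
\<close>

lemma pos_def_inverse_factorization: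
  fixes S :: "real^'p^'p"
  assumes S: "pos_def S"
  shows "invertible S" "\<exists>B::real^'p^'p. B ** transpose B = matrix_inv S"
proof -
  obtain b :: "'p \<Rightarrow> real^'p" where b: "\<And>i j. b i \<bullet> (S *v b j) = (if i = j then 1 else 0)"
    using pos_def_orthonormal_family[OF S, of UNIV] by auto
  define B :: "real^'p^'p" where "B = (\<chi> r c. b c $ r)"
  have "(transpose B ** (S ** B)) $ i $ j = b i \<bullet> (S *v b j)" for i j
    by (simp add: matrix_matrix_mult_def transpose_def B_def inner_vec_def matrix_vector_mult_def)
  hence "transpose B ** (S ** B) = mat 1" using b by (simp add: vec_eq_iff mat_def)
  hence "(transpose B ** S) ** B = mat 1" by (simp only: matrix_mul_assoc)
  hence "B ** (transpose B ** S) = mat 1" using matrix_left_right_inverse by blast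
  hence 1: "(B ** transpose B) ** S = mat 1" by (simp only: matrix_mul_assoc)
  thus inv: "invertible S" using invertible_left_inverse by blast
  have "B ** transpose B = matrix_inv S"
  proof -
    have "(B ** transpose B) *v v = matrix_inv S *v v" for v
      using 1 matrix_inv_mult_vec(2)[OF inv, of v] by (metis matrix_vector_mul_assoc matrix_vector_mul_lid)
    thus ?thesis by (simp add: matrix_eq)
  qed
  thus "\<exists>B::real^'p^'p. B ** transpose B = matrix_inv S" by blast
qed

text \<open>
  Passes from products over the index type, which define the standard normal density, to products
  over the abstract basis, for which Lebesgue measure is known to be a product measure.
\<close>

lemma prod_component_eq_prod_Basis:
  fixes h :: "'p::finite \<Rightarrow> real \<Rightarrow> 'b::comm_monoid_mult" and z :: "real^'p"
  shows "(\<Prod>k\<in>UNIV. h k (z $ k)) = (\<Prod>b\<in>Basis. h (inv (\<lambda>k. axis k 1) b) (z \<bullet> b))"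
proof -
  have inj: "inj (\<lambda>k::'p. axis k (1::real))" by (auto simp: inj_def axis_eq_axis)
  have "(\<Prod>b\<in>range (\<lambda>k::'p. axis k (1::real)). h (inv (\<lambda>k. axis k 1) b) (z \<bullet> b)) = (\<Prod>k\<in>UNIV. h k (z $ k))"
    by (subst prod.reindex[OF inj]) (simp add: inv_f_f[OF inj] cart_eq_inner_axis)
  moreover have "range (\<lambda>k::'p. axis k (1::real)) = Basis" by (auto simp: Basis_vec_def)
  ultimately show ?thesis by simp
qed

lemma prob_space_std_mv_normal: "prob_space (std_mv_normal :: (real^'p) measure)"
proof
  have "emeasure (std_mv_normal :: (real^'p) measure) (space std_mv_normal)
      = (\<integral>\<^sup>+z. (\<Prod>k\<in>UNIV. ennreal (std_normal_density (z $ k))) \<partial>(lborel :: (real^'p) measure))"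
    by (simp add: std_mv_normal_def emeasure_density prod_ennreal)
  also have "\<dots> = (\<integral>\<^sup>+z. (\<Prod>b\<in>Basis. ennreal (std_normal_density (z \<bullet> b))) \<partial>(lborel :: (real^'p) measure))"
    by (subst prod_component_eq_prod_Basis) simp
  also have "\<dots> = (\<Prod>b\<in>(Basis :: (real^'p) set). \<integral>\<^sup>+x. ennreal (std_normal_density x) \<partial>lborel)"
    by (intro nn_integral_lborel_prod) auto
  also have "(\<integral>\<^sup>+x. ennreal (std_normal_density x) \<partial>lborel) = 1"
    by (subst nn_integral_eq_integral) (auto simp: integrable_normal_density integral_normal_density)
  finally show "emeasure (std_mv_normal :: (real^'p) measure) (space std_mv_normal) = 1" by simp
qed

lemma sets_std_mv_normal[simp]: "sets std_mv_normal = sets borel"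
  by (simp add: std_mv_normal_def)

lemma integral_lborel_prod:
  fixes h :: "'v::euclidean_space \<Rightarrow> real \<Rightarrow> complex"
  assumes "\<And>b. b \<in> Basis \<Longrightarrow> integrable lborel (h b)"
  shows "(\<integral>z. (\<Prod>b\<in>Basis. h b (z \<bullet> b)) \<partial>lborel) = (\<Prod>b\<in>Basis. \<integral>x. h b x \<partial>lborel)"
proof -
  interpret product_sigma_finite "\<lambda>_::'v. lborel :: real measure" by standard
  have [measurable]: "h b \<in> borel_measurable borel" if "b \<in> Basis" for b
    using borel_measurable_integrable[OF assms[OF that]] by simp
  have "(\<integral>z. (\<Prod>b\<in>Basis. h b (z \<bullet> b)) \<partial>lborel)
      = (\<integral>f. (\<Prod>b\<in>Basis. h b (f b)) \<partial>(\<Pi>\<^sub>M b\<in>(Basis::'v set). lborel))"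
    by (subst lborel_eq) (simp add: integral_distr)
  also have "\<dots> = (\<Prod>b\<in>Basis. \<integral>x. h b x \<partial>lborel)"
    by (rule product_integral_prod) (use assms in auto)
  finally show ?thesis .
qed

text \<open>
  The integrand factorises over the coordinates, so the value is a product of one-dimensional
  Gaussian characteristic functions.
\<close>

lemma integral_std_mv_normal_iexp:
  fixes w :: "real^'p"
  shows "(\<integral>z. iexp (w \<bullet> z) \<partial>std_mv_normal) = complex_of_real (exp (- (w \<bullet> w) / 2))"
proof -
  have int: "integrable lborel (\<lambda>x. std_normal_density x *\<^sub>R iexp (s * x))" for s
    by (rule Bochner_Integration.integrable_bound[OF integrable_normal_density[of 1 0]]) auto
  have one: "(\<integral>x. std_normal_density x *\<^sub>R iexp (s * x) \<partial>lborel) = complex_of_real (exp (- s\<^sup>2 / 2))" for s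
  proof -
    have "(\<integral>x. std_normal_density x *\<^sub>R iexp (s * x) \<partial>lborel) = char std_normal_distribution s"
      unfolding char_def by (subst integral_density) auto
    thus ?thesis by (simp add: char_std_normal_distribution)
  qed
  have "(\<integral>z. iexp (w \<bullet> z) \<partial>std_mv_normal)
      = (\<integral>z. (\<Prod>k\<in>UNIV. std_normal_density (z $ k)) *\<^sub>R iexp (w \<bullet> z) \<partial>lborel)"
    unfolding std_mv_normal_def by (subst integral_density) (auto intro!: prod_nonneg)
  also have "\<dots> = (\<integral>z. (\<Prod>k\<in>UNIV. std_normal_density (z $ k) *\<^sub>R iexp (w $ k * z $ k)) \<partial>lborel)"
  proof (rule Bochner_Integration.integral_cong[OF refl])
    fix z :: "real^'p"
    have "iexp (w \<bullet> z) = (\<Prod>k\<in>UNIV. iexp (w $ k * z $ k))"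
      by (simp add: inner_vec_def sum_distrib_left exp_sum)
    thus "(\<Prod>k\<in>UNIV. std_normal_density (z $ k)) *\<^sub>R iexp (w \<bullet> z)
        = (\<Prod>k\<in>UNIV. std_normal_density (z $ k) *\<^sub>R iexp (w $ k * z $ k))"
      by (simp only: scaleR_conv_of_real of_real_prod prod.distrib)
  qed
  also have "\<dots> = (\<integral>z. (\<Prod>b\<in>Basis. std_normal_density (z \<bullet> b) *\<^sub>R iexp (w $ inv (\<lambda>k. axis k 1) b * (z \<bullet> b)))
                    \<partial>(lborel :: (real^'p) measure))"
    by (subst prod_component_eq_prod_Basis) (rule refl)
  also have "\<dots> = (\<Prod>b\<in>(Basis :: (real^'p) set). complex_of_real (exp (- (w $ inv (\<lambda>k. axis k 1) b)\<^sup>2 / 2)))"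
    by (subst integral_lborel_prod) (use int one in auto)
  also have "\<dots> = (\<Prod>k\<in>UNIV. complex_of_real (exp (- (w $ k)\<^sup>2 / 2)))"
    by (subst prod_component_eq_prod_Basis[of "\<lambda>k _. complex_of_real (exp (- (w $ k)\<^sup>2 / 2))" 0]) (rule refl)
  also have "\<dots> = complex_of_real (exp (\<Sum>k\<in>UNIV. - (w $ k)\<^sup>2 / 2))"
    by (simp add: exp_sum)
  also have "(\<Sum>k\<in>UNIV. - (w $ k)\<^sup>2 / 2) = - (w \<bullet> w) / 2"
    by (simp add: inner_vec_def power2_eq_square sum_negf flip: sum_divide_distrib)
  finally show ?thesis .
qed

text \<open>
  For any \<open>A\<close> with \<open>A A' = V\<close>, the projection \<open>t \<bullet> A z = (A' t) \<bullet> z\<close> has the characteristic function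
  \<open>exp (- u\<^sup>2 |A' t|\<^sup>2 / 2)\<close> at \<open>u\<close>, and \<open>|A' t|\<^sup>2 = t \<bullet> V t\<close> does not depend on the choice of \<open>A\<close>.
\<close>

lemma mv_normal_projection:
  fixes V :: "real^'p^'p"
  assumes "\<exists>A::real^'p^'p. A ** transpose A = V"
  shows "prob_space (mv_normal m V)" "sets (mv_normal m V) = sets borel"
    and "distr (mv_normal 0 V) borel (\<lambda>x. t \<bullet> x) = normal_law 0 (t \<bullet> (V *v t))"
proof -
  define A where "A = (SOME A::real^'p^'p. A ** transpose A = V)"
  have A: "A ** transpose A = V" unfolding A_def using assms by (rule someI_ex)
  have meas: "(\<lambda>z. m + A *v z) \<in> borel_measurable borel" for m
    by (intro borel_measurable_continuous_onI continuous_intros)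
  have [measurable]: "(\<lambda>z. m + A *v z) \<in> borel_measurable std_mv_normal" for m
    using meas by (simp cong: measurable_cong_sets)
  from this[of 0] have *: "((*v) A) \<in> borel_measurable std_mv_normal" by simp
  interpret S: prob_space "std_mv_normal :: (real^'p) measure" by (rule prob_space_std_mv_normal)
  show "prob_space (mv_normal m V)"
    unfolding mv_normal_def A_def[symmetric] by (rule S.prob_space_distr) measurable
  show "sets (mv_normal m V) = sets borel" by (simp add: mv_normal_def)
  have eq: "distr (mv_normal 0 V) borel (\<lambda>x. t \<bullet> x) = distr std_mv_normal borel (\<lambda>z. t \<bullet> (A *v z))"
    unfolding mv_normal_def A_def[symmetric] by (subst distr_distr) (use * in \<open>auto simp: comp_def\<close>)
  have m[measurable]: "(\<lambda>z. t \<bullet> (A *v z)) \<in> borel_measurable std_mv_normal"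
    using borel_measurable_inner[OF borel_measurable_const *] .
  have quad: "t \<bullet> (V *v t) = (transpose A *v t) \<bullet> (transpose A *v t)"
    by (metis A dot_lmul_matrix inner_commute matrix_vector_mul_assoc transpose_transpose vector_transpose_matrix)
  show "distr (mv_normal 0 V) borel (\<lambda>x. t \<bullet> x) = normal_law 0 (t \<bullet> (V *v t))"
  proof (rule Levy_uniqueness)
    show "real_distribution (distr (mv_normal 0 V) borel (\<lambda>x. t \<bullet> x))"
      unfolding eq by (rule S.real_distribution_distr) measurable
    show "real_distribution (normal_law 0 (t \<bullet> (V *v t)))" by (rule real_distribution_normal_law)
    show "char (distr (mv_normal 0 V) borel (\<lambda>x. t \<bullet> x)) = char (normal_law 0 (t \<bullet> (V *v t)))"
    proof
      fix u
      have tA: "t \<bullet> (A *v z) = (transpose A *v t) \<bullet> z" for z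
        by (metis dot_lmul_matrix transpose_transpose vector_transpose_matrix)
      have "char (distr (mv_normal 0 V) borel (\<lambda>x. t \<bullet> x)) u = (\<integral>z. iexp ((u *\<^sub>R (transpose A *v t)) \<bullet> z) \<partial>std_mv_normal)"
        unfolding eq char_def by (subst integral_distr[OF m]) (simp_all add: tA)
      also have "\<dots> = complex_of_real (exp (- (t \<bullet> (V *v t) * u\<^sup>2) / 2))"
        unfolding integral_std_mv_normal_iexp quad by (simp add: power2_eq_square mult_ac)
      also have "\<dots> = char (normal_law 0 (t \<bullet> (V *v t))) u"
        by (rule char_normal_law[symmetric]) (simp add: quad)
      finally show "char (distr (mv_normal 0 V) borel (\<lambda>x. t \<bullet> x)) u = char (normal_law 0 (t \<bullet> (V *v t))) u" .
    qed
  qed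
qed

text \<open>
  Each projection is a weighted sum with real weights \<open>t \<bullet> v n k\<close>, so the Cramer-Wold device reduces
  the claim to \<open>weighted_sum_clt\<close>.
\<close>

theorem (in prob_space) multivariate_weighted_sum_clt:
  fixes X :: "'i \<Rightarrow> 'a \<Rightarrow> real" and v :: "nat \<Rightarrow> 'i \<Rightarrow> real^'p"
  assumes indep: "indep_vars (\<lambda>_. borel) X I"
    and ident: "\<And>k k'. k \<in> I \<Longrightarrow> k' \<in> I \<Longrightarrow> distr M borel (X k) = distr M borel (X k')"
    and mean: "\<And>k. k \<in> I \<Longrightarrow> integrable M (X k) \<and> expectation (X k) = 0"
    and var: "\<And>k. k \<in> I \<Longrightarrow> integrable M (\<lambda>\<omega>. (X k \<omega>)\<^sup>2) \<and> expectation (\<lambda>\<omega>. (X k \<omega>)\<^sup>2) = \<sigma>\<^sup>2"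
    and K: "\<And>n. K n \<subseteq> I" "\<And>n. finite (K n)"
    and V: "\<exists>A::real^'p^'p. A ** transpose A = V"
    and sq: "\<And>t. (\<lambda>n. \<Sum>k\<in>K n. (t \<bullet> v n k)\<^sup>2) \<longlonglongrightarrow> t \<bullet> (V *v t)"
    and small: "\<And>t \<delta>. \<delta> > 0 \<Longrightarrow> \<forall>\<^sub>F n in sequentially. \<forall>k\<in>K n. \<bar>t \<bullet> v n k\<bar> \<le> \<delta>"
  shows "weak_conv_gen (\<lambda>n. distr M borel (\<lambda>\<omega>. \<Sum>k\<in>K n. X k \<omega> *\<^sub>R v n k)) (mv_normal 0 (\<sigma>\<^sup>2 *\<^sub>R V))"
proof (rule cramer_wold)
  have rv: "random_variable borel (X k)" if "k \<in> K n" for k n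
    using indep that K(1) unfolding indep_vars_def2 by blast
  have rvs[measurable]: "random_variable borel (\<lambda>\<omega>. \<Sum>k\<in>K n. X k \<omega> *\<^sub>R v n k)" for n
    by (intro borel_measurable_sum borel_measurable_scaleR rv) auto
  show "prob_space (distr M borel (\<lambda>\<omega>. \<Sum>k\<in>K n. X k \<omega> *\<^sub>R v n k))" for n by (rule prob_space_distr) measurable
  show "sets (distr M borel (\<lambda>\<omega>. \<Sum>k\<in>K n. X k \<omega> *\<^sub>R v n k)) = sets borel" for n by simp
  from V obtain A :: "real^'p^'p" where A: "A ** transpose A = V" ..
  have "(\<sigma> *\<^sub>R A) ** transpose (\<sigma> *\<^sub>R A) = \<sigma>\<^sup>2 *\<^sub>R (A ** transpose A)"
    by (simp add: power2_eq_square vec_eq_iff matrix_matrix_mult_def transpose_def sum_distrib_left mult_ac)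
  hence V': "\<exists>A::real^'p^'p. A ** transpose A = \<sigma>\<^sup>2 *\<^sub>R V" using A by blast
  show "prob_space (mv_normal 0 (\<sigma>\<^sup>2 *\<^sub>R V))" "sets (mv_normal 0 (\<sigma>\<^sup>2 *\<^sub>R V)) = sets borel"
    using mv_normal_projection(1,2)[OF V'] .
  fix t
  have "distr (distr M borel (\<lambda>\<omega>. \<Sum>k\<in>K n. X k \<omega> *\<^sub>R v n k)) borel (\<lambda>x. t \<bullet> x)
      = distr M borel (\<lambda>\<omega>. \<Sum>k\<in>K n. (t \<bullet> v n k) * X k \<omega>)" for n
    by (subst distr_distr) (auto simp: comp_def inner_sum_right mult.commute)
  moreover have "distr (mv_normal 0 (\<sigma>\<^sup>2 *\<^sub>R V)) borel (\<lambda>x. t \<bullet> x) = normal_law 0 (\<sigma>\<^sup>2 * (t \<bullet> (V *v t)))"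
    unfolding mv_normal_projection(3)[OF V'] by (simp add: scaleR_matrix_vector_assoc[symmetric])
  ultimately show "weak_conv_m (\<lambda>n. distr (distr M borel (\<lambda>\<omega>. \<Sum>k\<in>K n. X k \<omega> *\<^sub>R v n k)) borel (\<lambda>x. t \<bullet> x))
      (distr (mv_normal 0 (\<sigma>\<^sup>2 *\<^sub>R V)) borel (\<lambda>x. t \<bullet> x))"
    using weighted_sum_clt[OF indep ident mean var K sq small] by simp
qed

section \<open>Perturbations that vanish in mean square\<close>

lemma (in prob_space) indep_vars_reindex:
  assumes f: "inj_on f I" and indep: "indep_vars N X (f ` I)"
  shows "indep_vars (\<lambda>i. N (f i)) (\<lambda>i. X (f i)) I"
  unfolding indep_vars_def2 indep_sets_def
proof (intro conjI ballI allI impI)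
  note * = indep[unfolded indep_vars_def2 indep_sets_def]
  show rv: "random_variable (N (f i)) (X (f i))" if "i \<in> I" for i using * that by blast
  show "{X (f i) -` A \<inter> space M |A. A \<in> sets (N (f i))} \<subseteq> events" if "i \<in> I" for i
    using rv[OF that] by auto
  fix J A assume J: "J \<subseteq> I" "J \<noteq> {}" "finite J"
    and A: "A \<in> Pi J (\<lambda>i. {X (f i) -` A \<inter> space M |A. A \<in> sets (N (f i))})"
  have fJ: "inj_on f J" using f J(1) by (rule inj_on_subset)
  define A' where "A' = A \<circ> the_inv_into J f"
  have A': "A' (f j) = A j" if "j \<in> J" for j using that fJ by (simp add: A'_def the_inv_into_f_f)
  have "A' \<in> Pi (f ` J) (\<lambda>k. {X k -` A \<inter> space M |A. A \<in> sets (N k)})"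
  proof (rule Pi_I)
    fix k assume "k \<in> f ` J"
    then obtain j where j: "j \<in> J" "k = f j" by blast
    show "A' k \<in> {X k -` A \<inter> space M |A. A \<in> sets (N k)}"
      unfolding j(2) A'[OF j(1)] by (rule Pi_mem[OF A j(1)])
  qed
  hence "prob (\<Inter>k\<in>f ` J. A' k) = (\<Prod>k\<in>f ` J. prob (A' k))"
    by (intro *[THEN conjunct2, THEN conjunct2, rule_format]) (use J in auto)
  thus "prob (\<Inter>j\<in>J. A j) = (\<Prod>j\<in>J. prob (A j))" using A' by (simp add: prod.reindex[OF fJ])
qed

text \<open>Centred independent variables are orthogonal, so the mixed terms of the square integrate to zero.\<close>

lemma (in prob_space) second_moment_weighted_sum:
  fixes X :: "'i \<Rightarrow> 'a \<Rightarrow> real"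
  assumes indep: "indep_vars (\<lambda>_. borel) X K" and "finite K"
    and mean: "\<And>k. k \<in> K \<Longrightarrow> integrable M (X k) \<and> expectation (X k) = 0"
    and var: "\<And>k. k \<in> K \<Longrightarrow> integrable M (\<lambda>\<omega>. (X k \<omega>)\<^sup>2) \<and> expectation (\<lambda>\<omega>. (X k \<omega>)\<^sup>2) = v"
  shows "integrable M (\<lambda>\<omega>. (\<Sum>k\<in>K. a k * X k \<omega>)\<^sup>2)"
    and "expectation (\<lambda>\<omega>. (\<Sum>k\<in>K. a k * X k \<omega>)\<^sup>2) = v * (\<Sum>k\<in>K. (a k)\<^sup>2)"
proof -
  have sq: "(\<lambda>\<omega>. (\<Sum>k\<in>K. a k * X k \<omega>)\<^sup>2) = (\<lambda>\<omega>. \<Sum>i\<in>K. \<Sum>j\<in>K. a i * a j * (X i \<omega> * X j \<omega>))"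
    by (simp add: power2_eq_square sum_product mult_ac)
  have prod: "integrable M (\<lambda>\<omega>. X i \<omega> * X j \<omega>) \<and> expectation (\<lambda>\<omega>. X i \<omega> * X j \<omega>) = (if i = j then v else 0)"
    if ij: "i \<in> K" "j \<in> K" for i j
  proof (cases "i = j")
    case True thus ?thesis using var ij by (simp add: power2_eq_square)
  next
    case False
    have "indep_vars (\<lambda>_. borel) X {i, j}" using ij by (intro indep_vars_subset[OF indep]) auto
    from indep_vars_lebesgue_integral[OF _ this] indep_vars_integrable[OF _ this]
    show ?thesis using False mean ij by auto
  qed
  show "integrable M (\<lambda>\<omega>. (\<Sum>k\<in>K. a k * X k \<omega>)\<^sup>2)"
    unfolding sq using prod by (intro Bochner_Integration.integrable_sum integrable_mult_right) auto
  have "expectation (\<lambda>\<omega>. (\<Sum>k\<in>K. a k * X k \<omega>)\<^sup>2) = (\<Sum>i\<in>K. \<Sum>j\<in>K. a i * a j * (if i = j then v else 0))"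
    unfolding sq using prod
    by (subst Bochner_Integration.integral_sum, simp, intro sum.cong refl)
      (subst Bochner_Integration.integral_sum, auto intro!: sum.cong)
  also have "\<dots> = v * (\<Sum>k\<in>K. (a k)\<^sup>2)"
    using \<open>finite K\<close> by (simp add: sum_distrib_left power2_eq_square mult_ac if_distrib sum.delta cong: if_cong)
  finally show "expectation (\<lambda>\<omega>. (\<Sum>k\<in>K. a k * X k \<omega>)\<^sup>2) = v * (\<Sum>k\<in>K. (a k)\<^sup>2)" .
qed

text \<open>
  Since \<open>|exp (\<i> t (x + y)) - exp (\<i> t x)| \<le> |t| |y|\<close>, adding \<open>Y n\<close> changes the characteristic function at \<open>t\<close> by
  at most \<open>|t| E|Y n| \<le> |t| sqrt (E (Y n)\<^sup>2)\<close>.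
\<close>

theorem (in prob_space) slutsky_mean_square:
  fixes X Y :: "nat \<Rightarrow> 'a \<Rightarrow> real"
  assumes X: "\<And>n. random_variable borel (X n)" and Y: "\<And>n. random_variable borel (Y n)"
    and \<nu>: "real_distribution \<nu>" and conv: "weak_conv_m (\<lambda>n. distr M borel (X n)) \<nu>"
    and int: "\<And>n. integrable M (\<lambda>\<omega>. (Y n \<omega>)\<^sup>2)"
    and lim: "(\<lambda>n. expectation (\<lambda>\<omega>. (Y n \<omega>)\<^sup>2)) \<longlonglongrightarrow> 0"
  shows "weak_conv_m (\<lambda>n. distr M borel (\<lambda>\<omega>. X n \<omega> + Y n \<omega>)) \<nu>"
proof (rule levy_continuity)
  note [measurable] = X Y
  show "real_distribution (distr M borel (\<lambda>\<omega>. X n \<omega> + Y n \<omega>))" for n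
    by (rule real_distribution_distr) measurable
  show "real_distribution \<nu>" by fact
  fix t
  have char_X: "(\<lambda>n. char (distr M borel (X n)) t) \<longlonglongrightarrow> char \<nu> t"
    by (rule levy_continuity1[OF real_distribution_distr[OF X] \<nu> conv])
  have bound: "norm (char (distr M borel (\<lambda>\<omega>. X n \<omega> + Y n \<omega>)) t - char (distr M borel (X n)) t)
      \<le> \<bar>t\<bar> * sqrt (expectation (\<lambda>\<omega>. (Y n \<omega>)\<^sup>2))" for n
  proof -
    have intY: "integrable M (Y n)" by (rule square_integrable_imp_integrable[OF Y int])
    have i: "integrable M (\<lambda>\<omega>. iexp (t * Z \<omega>))" if "random_variable borel Z" for Z :: "'a \<Rightarrow> real"
      using that by (intro integrable_iexp) auto
    have char_eq: "char (distr M borel Z) t = (\<integral>\<omega>. iexp (t * Z \<omega>) \<partial>M)"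
      if "random_variable borel Z" for Z :: "'a \<Rightarrow> real"
      using that unfolding char_def by (subst integral_distr) auto
    have "char (distr M borel (\<lambda>\<omega>. X n \<omega> + Y n \<omega>)) t - char (distr M borel (X n)) t
        = (\<integral>\<omega>. iexp (t * (X n \<omega> + Y n \<omega>)) - iexp (t * X n \<omega>) \<partial>M)"
      by (subst (1 2) char_eq, measurable, rule Bochner_Integration.integral_diff[symmetric]; rule i) measurable
    also have "norm \<dots> \<le> (\<integral>\<omega>. norm (iexp (t * (X n \<omega> + Y n \<omega>)) - iexp (t * X n \<omega>)) \<partial>M)"
      by (rule integral_norm_bound)
    also have "\<dots> \<le> (\<integral>\<omega>. \<bar>t\<bar> * \<bar>Y n \<omega>\<bar> \<partial>M)"
    proof (rule integral_mono)
      show "integrable M (\<lambda>\<omega>. norm (iexp (t * (X n \<omega> + Y n \<omega>)) - iexp (t * X n \<omega>)))"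
        by (intro integrable_norm Bochner_Integration.integrable_diff i) auto
      show "integrable M (\<lambda>\<omega>. \<bar>t\<bar> * \<bar>Y n \<omega>\<bar>)" using intY by auto
      fix \<omega>
      have "iexp (t * (X n \<omega> + Y n \<omega>)) - iexp (t * X n \<omega>) = iexp (t * X n \<omega>) * (iexp (t * Y n \<omega>) - 1)"
        by (simp add: algebra_simps exp_add)
      hence "norm (iexp (t * (X n \<omega> + Y n \<omega>)) - iexp (t * X n \<omega>)) = norm (iexp (t * Y n \<omega>) - 1)"
        by (simp add: norm_mult)
      also have "\<dots> \<le> \<bar>t * Y n \<omega>\<bar>" using iexp_approx1[of "t * Y n \<omega>" 0] by simp
      finally show "norm (iexp (t * (X n \<omega> + Y n \<omega>)) - iexp (t * X n \<omega>)) \<le> \<bar>t\<bar> * \<bar>Y n \<omega>\<bar>"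
        by (simp add: abs_mult)
    qed
    also have "\<dots> = \<bar>t\<bar> * expectation (\<lambda>\<omega>. \<bar>Y n \<omega>\<bar>)" by simp
    also have "expectation (\<lambda>\<omega>. \<bar>Y n \<omega>\<bar>) \<le> sqrt (expectation (\<lambda>\<omega>. (Y n \<omega>)\<^sup>2))"
    proof (rule real_le_rsqrt)
      have "0 \<le> variance (\<lambda>\<omega>. \<bar>Y n \<omega>\<bar>)" by (rule variance_positive)
      also have "\<dots> = expectation (\<lambda>\<omega>. \<bar>Y n \<omega>\<bar>\<^sup>2) - (expectation (\<lambda>\<omega>. \<bar>Y n \<omega>\<bar>))\<^sup>2"
        using intY int by (intro variance_eq) auto
      finally show "(expectation (\<lambda>\<omega>. \<bar>Y n \<omega>\<bar>))\<^sup>2 \<le> expectation (\<lambda>\<omega>. (Y n \<omega>)\<^sup>2)" by simp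
    qed
    finally show ?thesis by (simp add: mult_left_mono)
  qed
  have "(\<lambda>n. char (distr M borel (\<lambda>\<omega>. X n \<omega> + Y n \<omega>)) t - char (distr M borel (X n)) t) \<longlonglongrightarrow> 0"
  proof (rule Lim_null_comparison[OF always_eventually])
    show "\<forall>n. norm (char (distr M borel (\<lambda>\<omega>. X n \<omega> + Y n \<omega>)) t - char (distr M borel (X n)) t)
      \<le> \<bar>t\<bar> * sqrt (expectation (\<lambda>\<omega>. (Y n \<omega>)\<^sup>2))" using bound by blast
    have "(\<lambda>n. \<bar>t\<bar> * sqrt (expectation (\<lambda>\<omega>. (Y n \<omega>)\<^sup>2))) \<longlonglongrightarrow> \<bar>t\<bar> * sqrt 0"
      by (intro tendsto_intros lim)
    thus "(\<lambda>n. \<bar>t\<bar> * sqrt (expectation (\<lambda>\<omega>. (Y n \<omega>)\<^sup>2))) \<longlonglongrightarrow> 0" by simp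
  qed
  with char_X show "(\<lambda>n. char (distr M borel (\<lambda>\<omega>. X n \<omega> + Y n \<omega>)) t) \<longlonglongrightarrow> char \<nu> t"
    by (rule Lim_transform)
qed

lemma weak_conv_m_cong_eventually:
  assumes "\<forall>\<^sub>F n in sequentially. \<mu> n = \<mu>' n" "weak_conv_m \<mu>' \<nu>"
  shows "weak_conv_m \<mu> \<nu>"
  unfolding weak_conv_m_def weak_conv_def
proof (intro allI impI)
  fix x assume "isCont (cdf \<nu>) x"
  hence lim: "(\<lambda>n. cdf (\<mu>' n) x) \<longlonglongrightarrow> cdf \<nu> x"
    using assms(2) by (simp add: weak_conv_m_def weak_conv_def)
  show "(\<lambda>n. cdf (\<mu> n) x) \<longlonglongrightarrow> cdf \<nu> x"
    by (rule Lim_transform_eventually[OF lim], rule eventually_mono[OF assms(1)]) simp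
qed

lemma weak_conv_gen_cong_eventually:
  assumes "\<forall>\<^sub>F n in sequentially. \<mu> n = \<mu>' n" "weak_conv_gen \<mu>' \<nu>"
  shows "weak_conv_gen \<mu> \<nu>"
  unfolding weak_conv_gen_def
proof (intro allI impI)
  fix f :: "'a \<Rightarrow> real" assume "continuous_on UNIV f" "bounded (range f)"
  hence lim: "(\<lambda>n. integral\<^sup>L (\<mu>' n) f) \<longlonglongrightarrow> integral\<^sup>L \<nu> f"
    using assms(2) by (simp add: weak_conv_gen_def)
  show "(\<lambda>n. integral\<^sup>L (\<mu> n) f) \<longlonglongrightarrow> integral\<^sup>L \<nu> f"
    by (rule Lim_transform_eventually[OF lim], rule eventually_mono[OF assms(1)]) simp
qed

section \<open>Inverses of matrices near a positive definite one\<close>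

lemma norm_matrix_vector_mult_le:
  fixes A :: "real^'p^'q"
  shows "norm (A *v v) \<le> norm A * norm v"
proof -
  have "norm (A *v v) = L2_set (\<lambda>i. \<bar>A $ i \<bullet> v\<bar>) UNIV"
    by (simp add: norm_vec_def matrix_mult_dot)
  also have "\<dots> \<le> L2_set (\<lambda>i. norm (A $ i) * norm v) UNIV"
    by (intro L2_set_mono) (auto simp: Cauchy_Schwarz_ineq2)
  also have "\<dots> = norm A * norm v"
    by (simp add: norm_vec_def L2_set_left_distrib)
  finally show ?thesis .
qed

text \<open>The constant is the minimum of the quadratic form on the unit sphere, which is attained by compactness.\<close>

lemma pos_def_coercive:
  fixes S :: "real^'p^'p"
  assumes "pos_def S"
  shows "\<exists>c>0. \<forall>v. c * (v \<bullet> v) \<le> v \<bullet> (S *v v)"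
proof -
  have "continuous_on (sphere 0 1) (\<lambda>v. v \<bullet> (S *v v))" by (intro continuous_intros)
  moreover have "compact (sphere (0::real^'p) 1)" by simp
  moreover have "sphere (0::real^'p) 1 \<noteq> {}" by (simp add: sphere_eq_empty)
  ultimately obtain u where u: "u \<in> sphere 0 1" "\<And>v. v \<in> sphere 0 1 \<Longrightarrow> u \<bullet> (S *v u) \<le> v \<bullet> (S *v v)"
    using continuous_attains_inf[of "sphere 0 1" "\<lambda>v. v \<bullet> (S *v v)"] by blast
  define c where "c = u \<bullet> (S *v u)"
  have "u \<noteq> 0" using u(1) by auto
  hence "c > 0" using assms by (simp add: c_def pos_def_def)
  moreover have "c * (v \<bullet> v) \<le> v \<bullet> (S *v v)" for v
  proof (cases "v = 0")
    case False
    define w where "w = (1 / norm v) *\<^sub>R v"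
    have v: "v = norm v *\<^sub>R w" using False by (simp add: w_def)
    have "w \<in> sphere 0 1" using False by (simp add: w_def)
    hence "c \<le> w \<bullet> (S *v w)" unfolding c_def by (rule u(2))
    hence "(norm v)\<^sup>2 * c \<le> (norm v)\<^sup>2 * (w \<bullet> (S *v w))" by (intro mult_left_mono) auto
    also have "\<dots> = (norm v *\<^sub>R w) \<bullet> (S *v (norm v *\<^sub>R w))"
      by (simp add: matrix_vector_mult_scaleR power2_eq_square)
    also have "\<dots> = v \<bullet> (S *v v)" by (simp only: v[symmetric])
    finally show ?thesis by (simp add: power2_norm_eq_inner mult.commute)
  qed simp
  ultimately show ?thesis by blast
qed

lemma coercive_inverse:
  fixes S :: "real^'p^'p"
  assumes c: "c > 0" "\<And>v. c * (v \<bullet> v) \<le> v \<bullet> (S *v v)"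
  shows "invertible S" "norm (matrix_inv S *v t) \<le> norm t / c"
proof -
  have below: "c * norm v \<le> norm (S *v v)" for v
  proof (cases "v = 0")
    case False
    have "(c * norm v) * norm v = c * (v \<bullet> v)" by (simp add: power2_eq_square flip: power2_norm_eq_inner)
    also have "\<dots> \<le> v \<bullet> (S *v v)" by (rule c)
    also have "\<dots> \<le> norm (S *v v) * norm v" by (metis inner_commute norm_cauchy_schwarz)
    finally show ?thesis using False by simp
  qed simp
  have "\<forall>v. S *v v = 0 \<longrightarrow> v = 0"
  proof (intro allI impI)
    fix v assume "S *v v = 0"
    with below[of v] have "c * norm v \<le> 0" by simp
    thus "v = 0" using c(1) by (simp add: mult_le_0_iff)
  qed
  thus inv: "invertible S" using matrix_left_invertible_ker[of S] invertible_left_inverse[of S] by blast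
  have "c * norm (matrix_inv S *v t) \<le> norm t"
    using below[of "matrix_inv S *v t"] by (simp add: matrix_inv_mult_vec(2)[OF inv])
  thus "norm (matrix_inv S *v t) \<le> norm t / c" using c(1) by (simp add: pos_le_divide_eq mult.commute)
qed

text \<open>
  Coercivity survives a small perturbation, at the price of half the constant. This gives
  invertibility and, through \<open>coercive_inverse\<close>, one bound for all the inverses.
\<close>

lemma eventually_coercive:
  fixes S :: "nat \<Rightarrow> real^'p^'p"
  assumes lim: "S \<longlonglongrightarrow> \<Sigma>" and \<Sigma>: "pos_def \<Sigma>"
  obtains c where "c > 0" "\<forall>\<^sub>F n in sequentially. \<forall>v. c * (v \<bullet> v) \<le> v \<bullet> (S n *v v)"
proof -
  obtain c where c: "c > 0" "\<And>v. c * (v \<bullet> v) \<le> v \<bullet> (\<Sigma> *v v)" using pos_def_coercive[OF \<Sigma>] by blast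
  have "\<forall>\<^sub>F n in sequentially. dist (S n) \<Sigma> < c / 2" using lim c(1) by (intro tendstoD) auto
  hence "\<forall>\<^sub>F n in sequentially. \<forall>v. c / 2 * (v \<bullet> v) \<le> v \<bullet> (S n *v v)"
  proof eventually_elim
    case (elim n)
    show ?case
    proof
      fix v
      have "- (v \<bullet> ((S n - \<Sigma>) *v v)) \<le> norm v * norm ((S n - \<Sigma>) *v v)"
        by (metis abs_le_D2 Cauchy_Schwarz_ineq2)
      also have "\<dots> \<le> norm v * (norm (S n - \<Sigma>) * norm v)"
        by (intro mult_left_mono norm_matrix_vector_mult_le) auto
      also have "\<dots> = norm (S n - \<Sigma>) * (v \<bullet> v)" by (simp add: power2_eq_square flip: power2_norm_eq_inner)
      also have "\<dots> \<le> c / 2 * (v \<bullet> v)" using elim by (intro mult_right_mono) (auto simp: dist_norm)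
      finally have "v \<bullet> (\<Sigma> *v v) - v \<bullet> (S n *v v) \<le> c / 2 * (v \<bullet> v)"
        by (simp add: matrix_vector_mult_diff_rdistrib inner_diff_right)
      thus "c / 2 * (v \<bullet> v) \<le> v \<bullet> (S n *v v)" using c(2)[of v] by simp
    qed
  qed
  thus ?thesis using that[of "c / 2"] c(1) by simp
qed

text \<open>
  The resolvent identity \<open>S\<^sup>-\<^sup>1 t - \<Sigma>\<^sup>-\<^sup>1 t = S\<^sup>-\<^sup>1 ((\<Sigma> - S) \<Sigma>\<^sup>-\<^sup>1 t)\<close> together with the uniform bound on \<open>S\<^sup>-\<^sup>1\<close>.
\<close>

lemma tendsto_matrix_inv_mult_vec:
  fixes S :: "nat \<Rightarrow> real^'p^'p"
  assumes lim: "S \<longlonglongrightarrow> \<Sigma>" and \<Sigma>: "pos_def \<Sigma>"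
  shows "(\<lambda>n. matrix_inv (S n) *v t) \<longlonglongrightarrow> matrix_inv \<Sigma> *v t"
proof -
  obtain c where c: "c > 0" "\<forall>\<^sub>F n in sequentially. \<forall>v. c * (v \<bullet> v) \<le> v \<bullet> (S n *v v)"
    using eventually_coercive[OF lim \<Sigma>] .
  define w where "w = matrix_inv \<Sigma> *v t"
  have "(\<lambda>n. matrix_inv (S n) *v t - w) \<longlonglongrightarrow> 0"
  proof (rule Lim_null_comparison)
    show "\<forall>\<^sub>F n in sequentially. norm (matrix_inv (S n) *v t - w) \<le> norm (S n - \<Sigma>) * norm w / c"
      using c(2)
    proof eventually_elim
      case (elim n)
      note inv = coercive_inverse[OF c(1), of "S n"]
      have "matrix_inv (S n) *v t - w = matrix_inv (S n) *v (\<Sigma> *v w - S n *v w)"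
        using elim by (simp add: w_def matrix_inv_mult_vec pos_def_inverse_factorization(1)[OF \<Sigma>] inv(1)
            matrix_vector_mult_diff_distrib)
      also have "\<dots> = - (matrix_inv (S n) *v ((S n - \<Sigma>) *v w))"
        by (simp add: matrix_vector_mult_diff_rdistrib matrix_vector_mult_diff_distrib)
      finally have "norm (matrix_inv (S n) *v t - w) = norm (matrix_inv (S n) *v ((S n - \<Sigma>) *v w))" by simp
      also have "\<dots> \<le> norm ((S n - \<Sigma>) *v w) / c" using elim by (intro inv(2)) auto
      also have "\<dots> \<le> norm (S n - \<Sigma>) * norm w / c"
        using c(1) by (intro divide_right_mono norm_matrix_vector_mult_le) auto
      finally show ?case .
    qed
    have "(\<lambda>n. norm (S n - \<Sigma>) * norm w / c) \<longlonglongrightarrow> norm (\<Sigma> - \<Sigma>) * norm w / c"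
      using c(1) by (intro tendsto_intros lim) auto
    thus "(\<lambda>n. norm (S n - \<Sigma>) * norm w / c) \<longlonglongrightarrow> 0" by simp
  qed
  thus ?thesis by (simp add: w_def LIM_zero_iff)
qed

section \<open>The estimation errors as weighted sums\<close>

definition obs_upto :: "(nat \<Rightarrow> nat) \<Rightarrow> nat \<Rightarrow> (nat \<times> nat) set" where
  "obs_upto l n = (SIGMA i:{1..n}. {1..l i})"

definition deviation :: "(nat \<Rightarrow> nat) \<Rightarrow> (nat \<Rightarrow> nat \<Rightarrow> 'v::real_vector) \<Rightarrow> nat \<times> nat \<Rightarrow> 'v" where
  "deviation l x = (\<lambda>(i, j). x i j - group_mean l x i)"

lemma finite_obs_upto: "finite (obs_upto l n)"
  and obs_upto_subset: "obs_upto l n \<subseteq> obs_index l"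
  and sum_obs_upto: "(\<Sum>k\<in>obs_upto l n. g k) = (\<Sum>i=1..n. \<Sum>j=1..l i. g (i, j))"
  by (auto simp: obs_upto_def obs_index_def sum.Sigma)

lemma sum_deviation:
  assumes "l i \<ge> 1"
  shows "(\<Sum>j=1..l i. deviation l x (i, j)) = 0"
proof -
  have "(\<Sum>j=1..l i. deviation l x (i, j)) = (\<Sum>j=1..l i. x i j) - real (l i) *\<^sub>R group_mean l x i"
    by (simp add: deviation_def sum_subtractf sum_constant_scaleR)
  thus ?thesis using assms by (simp add: group_mean_def)
qed

lemma outer_mult_vec: "outer v *v w = (v \<bullet> w) *\<^sub>R v"
  by (simp add: outer_def vec_eq_iff matrix_vector_mult_def matrix_matrix_mult_def columnvector_def rowvector_def
      inner_vec_def sum_distrib_left sum_distrib_right mult_ac)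

lemma Sigma_hat_mult_vec:
  "Sigma_hat l x n *v w = (1 / real (total_size l n)) *\<^sub>R
     (\<Sum>k\<in>obs_upto l n. (deviation l x k \<bullet> w) *\<^sub>R deviation l x k)"
proof -
  have lin: "(\<Sum>k\<in>A. B k) *v w = (\<Sum>k\<in>A. B k *v w)" for A :: "'b set" and B :: "'b \<Rightarrow> real^'a^'a"
    by (induction A rule: infinite_finite_induct) (auto simp: matrix_vector_mult_add_rdistrib)
  show ?thesis
    by (simp add: Sigma_hat_def sum_obs_upto scaleR_matrix_vector_assoc[symmetric] lin outer_mult_vec deviation_def)
qed

lemma transpose_Sigma_hat: "transpose (Sigma_hat l x n) = Sigma_hat l x n"
proof -
  have "outer v $ i $ j = outer v $ j $ i" for v :: "real^'a" and i j
    by (simp add: outer_def matrix_matrix_mult_def columnvector_def rowvector_def mult_ac)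
  thus ?thesis
    by (simp add: Sigma_hat_def vec_eq_iff transpose_def sum_component)
qed

lemma symmetric_inverse:
  fixes S :: "real^'p^'p"
  assumes "transpose S = S" "invertible S"
  shows "u \<bullet> (matrix_inv S *v v) = (matrix_inv S *v u) \<bullet> v"
  using symmetric_form[OF assms(1), of "matrix_inv S *v u" "matrix_inv S *v v"]
  by (simp add: matrix_inv_mult_vec[OF assms(2)])

text \<open>
  With \<open>w = Sigma_hat\<^sup>-\<^sup>1 m\<close>, symmetry turns each weight into \<open>w \<bullet> deviation\<close>. The normalised sum of the squares is
  then the quadratic form of \<open>Sigma_hat\<close> at \<open>w\<close>, by the very definition of \<open>Sigma_hat\<close>, and
  \<open>Sigma_hat w = m\<close>.
\<close>

lemma estimator_weights_square_sum:
  assumes inv: "invertible (Sigma_hat l x n)"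
  shows "(\<Sum>k\<in>obs_upto l n. (m \<bullet> (matrix_inv (Sigma_hat l x n) *v deviation l x k))\<^sup>2) / real (total_size l n)
    = m \<bullet> (matrix_inv (Sigma_hat l x n) *v m)"
proof -
  define w where "w = matrix_inv (Sigma_hat l x n) *v m"
  note sym = symmetric_inverse[OF transpose_Sigma_hat inv]
  have "(\<Sum>k\<in>obs_upto l n. (m \<bullet> (matrix_inv (Sigma_hat l x n) *v deviation l x k))\<^sup>2) / real (total_size l n)
      = w \<bullet> (Sigma_hat l x n *v w)"
    by (simp add: Sigma_hat_mult_vec sym w_def[symmetric] inner_sum_right power2_eq_square inner_commute)
  also have "\<dots> = m \<bullet> w"
    by (simp add: w_def matrix_inv_mult_vec(2)[OF inv] inner_commute)
  finally show ?thesis by (simp add: w_def)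
qed

lemma group_mean_response:
  assumes "l i \<ge> 1" and y: "\<And>j. 1 \<le> j \<Longrightarrow> j \<le> l i \<Longrightarrow> y i j = \<alpha> + x i j \<bullet> \<beta> + b i + e (i, j)"
  shows "group_mean l y i = \<alpha> + group_mean l x i \<bullet> \<beta> + b i + group_mean l (\<lambda>i j. e (i, j)) i"
proof -
  have "(\<Sum>j=1..l i. y i j) = (\<Sum>j=1..l i. \<alpha> + x i j \<bullet> \<beta> + b i + e (i, j))"
    by (intro sum.cong refl y) auto
  also have "\<dots> = real (l i) * (\<alpha> + b i) + (\<Sum>j=1..l i. x i j) \<bullet> \<beta> + (\<Sum>j=1..l i. e (i, j))"
    by (simp add: sum.distrib inner_sum_left algebra_simps)
  finally show ?thesis using assms(1) by (simp add: group_mean_def field_simps)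
qed

text \<open>
  Centring the responses cancels \<open>\<alpha> + b i\<close>; the part \<open>deviation \<bullet> \<beta>\<close> reproduces \<open>Sigma_hat *v \<beta>\<close>. The
  group mean \<open>e'\<close> of the noise is constant within a group and hence drops out against the deviations, which
  sum to zero.
\<close>

lemma beta_hat_error:
  assumes l: "\<And>i. i \<ge> 1 \<Longrightarrow> l i \<ge> 1"
    and y: "\<And>i j. (i, j) \<in> obs_index l \<Longrightarrow> y i j = \<alpha> + x i j \<bullet> \<beta> + b i + e (i, j)"
    and inv: "invertible (Sigma_hat l x n)"
  shows "beta_hat l x y n - \<beta> = (\<Sum>k\<in>obs_upto l n.
      e k *\<^sub>R ((1 / real (total_size l n)) *\<^sub>R (matrix_inv (Sigma_hat l x n) *v deviation l x k)))"
proof -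
  let ?d = "deviation l x" and ?N = "real (total_size l n)" and ?S = "Sigma_hat l x n"
  have ymean: "group_mean l y i = \<alpha> + group_mean l x i \<bullet> \<beta> + b i + group_mean l (\<lambda>i j. e (i, j)) i"
    if "i \<ge> 1" for i
    by (rule group_mean_response) (use that l y in \<open>auto simp: obs_index_def\<close>)
  have inner: "(\<Sum>j=1..l i. (y i j - group_mean l y i) *\<^sub>R (x i j - group_mean l x i))
      = (\<Sum>j=1..l i. (?d (i, j) \<bullet> \<beta>) *\<^sub>R ?d (i, j) + e (i, j) *\<^sub>R ?d (i, j))" if i: "i \<ge> 1" for i
  proof -
    define e' where "e' = group_mean l (\<lambda>i j. e (i, j)) i"
    have "(\<Sum>j=1..l i. (y i j - group_mean l y i) *\<^sub>R (x i j - group_mean l x i))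
        = (\<Sum>j=1..l i. ((?d (i, j) \<bullet> \<beta>) *\<^sub>R ?d (i, j) + e (i, j) *\<^sub>R ?d (i, j)) - e' *\<^sub>R ?d (i, j))"
    proof (intro sum.cong refl)
      fix j assume "j \<in> {1..l i}"
      hence "y i j - group_mean l y i = ?d (i, j) \<bullet> \<beta> + e (i, j) - e'"
        using i by (simp add: y obs_index_def ymean e'_def deviation_def inner_diff_left)
      thus "(y i j - group_mean l y i) *\<^sub>R (x i j - group_mean l x i)
          = ((?d (i, j) \<bullet> \<beta>) *\<^sub>R ?d (i, j) + e (i, j) *\<^sub>R ?d (i, j)) - e' *\<^sub>R ?d (i, j)"
        by (simp add: deviation_def scaleR_left_distrib scaleR_left_diff_distrib)
    qed
    also have "\<dots> = (\<Sum>j=1..l i. (?d (i, j) \<bullet> \<beta>) *\<^sub>R ?d (i, j) + e (i, j) *\<^sub>R ?d (i, j))"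
      using sum_deviation[where l=l and i=i and x=x] l[OF i] by (simp add: sum_subtractf flip: scaleR_sum_right)
    finally show ?thesis .
  qed
  have "beta_hat l x y n = matrix_inv ?S *v ((1 / ?N) *\<^sub>R (\<Sum>k\<in>obs_upto l n. (?d k \<bullet> \<beta>) *\<^sub>R ?d k + e k *\<^sub>R ?d k))"
    unfolding beta_hat_def sum_obs_upto
    by (intro arg_cong[where f = "\<lambda>s. matrix_inv ?S *v ((1 / ?N) *\<^sub>R s)"] sum.cong refl inner) simp
  also have "\<dots> = matrix_inv ?S *v (?S *v \<beta> + (\<Sum>k\<in>obs_upto l n. e k *\<^sub>R ((1 / ?N) *\<^sub>R ?d k)))"
    by (simp add: Sigma_hat_mult_vec sum.distrib scaleR_right_distrib scaleR_sum_right mult_ac)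
  also have "\<dots> = \<beta> + (\<Sum>k\<in>obs_upto l n. e k *\<^sub>R ((1 / ?N) *\<^sub>R (matrix_inv ?S *v ?d k)))"
    by (simp add: matrix_vector_right_distrib matrix_inv_mult_vec(1)[OF inv]
        linear_sum[OF matrix_vector_mul_linear] matrix_vector_mult_scaleR)
  finally show ?thesis by simp
qed

text \<open>
  The noise enters twice, through the group means of the responses and through the error of
  \<open>beta_hat\<close>. Collecting both contributions in a single weighted sum of independent noise variables makes its
  second moment explicit.
\<close>

lemma alpha_hat_error:
  assumes l: "\<And>i. i \<ge> 1 \<Longrightarrow> l i \<ge> 1"
    and y: "\<And>i j. (i, j) \<in> obs_index l \<Longrightarrow> y i j = \<alpha> + x i j \<bullet> \<beta> + b i + e (i, j)"
    and inv: "invertible (Sigma_hat l x n)" and n: "n \<ge> 1"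
    and m: "m = (1 / real n) *\<^sub>R (\<Sum>i=1..n. group_mean l x i)"
  shows "alpha_hat l x y n - \<alpha> = (\<Sum>i=1..n. (1 / real n) * b i) +
      (\<Sum>k\<in>obs_upto l n. (1 / (real n * real (l (fst k)))
         - m \<bullet> (matrix_inv (Sigma_hat l x n) *v deviation l x k) / real (total_size l n)) * e k)"
proof -
  have ymean: "group_mean l y i = \<alpha> + group_mean l x i \<bullet> \<beta> + b i + (\<Sum>j=1..l i. e (i, j) / real (l i))"
    if "i \<ge> 1" for i
  proof -
    have "group_mean l y i = \<alpha> + group_mean l x i \<bullet> \<beta> + b i + group_mean l (\<lambda>i j. e (i, j)) i"
      by (rule group_mean_response) (use that l y in \<open>auto simp: obs_index_def\<close>)
    thus ?thesis by (simp add: group_mean_def[where z = "\<lambda>i j. e (i, j)"] sum_divide_distrib)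
  qed
  have "alpha_hat l x y n - \<alpha> = (1 / real n) * (\<Sum>i=1..n. \<alpha> + group_mean l x i \<bullet> \<beta> + b i + (\<Sum>j=1..l i. e (i, j) / real (l i)))
      - m \<bullet> beta_hat l x y n - \<alpha>"
    by (simp add: alpha_hat_def ymean m inner_sum_left)
  also have "\<dots> = (\<Sum>i=1..n. (1 / real n) * b i) + (\<Sum>i=1..n. \<Sum>j=1..l i. e (i, j) / (real n * real (l i)))
      - m \<bullet> (beta_hat l x y n - \<beta>)"
    using n by (simp add: sum.distrib m inner_sum_left inner_diff_right distrib_left sum_distrib_left mult_ac)
  also have "(\<Sum>i=1..n. \<Sum>j=1..l i. e (i, j) / (real n * real (l i)))
      = (\<Sum>k\<in>obs_upto l n. 1 / (real n * real (l (fst k))) * e k)"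
    by (simp add: sum_obs_upto)
  also have "m \<bullet> (beta_hat l x y n - \<beta>) = (\<Sum>k\<in>obs_upto l n.
      m \<bullet> (matrix_inv (Sigma_hat l x n) *v deviation l x k) / real (total_size l n) * e k)"
  proof -
    have "beta_hat l x y n - \<beta> = (\<Sum>k\<in>obs_upto l n.
        e k *\<^sub>R ((1 / real (total_size l n)) *\<^sub>R (matrix_inv (Sigma_hat l x n) *v deviation l x k)))"
      by (rule beta_hat_error[where \<alpha>=\<alpha> and b=b]) (use l y inv in auto)
    thus ?thesis by (simp add: inner_sum_right mult_ac)
  qed
  finally show ?thesis by (simp add: sum_subtractf left_diff_distrib)
qed

section \<open>Asymptotic normality of the estimators\<close>

theorem theorem2p1:
  fixes M :: "'a measure"
    and l :: "nat \<Rightarrow> nat"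
    and x :: "nat \<Rightarrow> nat \<Rightarrow> real^'p"
    and y :: "nat \<Rightarrow> nat \<Rightarrow> 'a \<Rightarrow> real"
    and b :: "nat \<Rightarrow> 'a \<Rightarrow> real"
    and eps :: "nat \<times> nat \<Rightarrow> 'a \<Rightarrow> real"
    and \<alpha> :: real and \<beta> :: "real^'p"
    and \<gamma>b \<gamma>e :: real
    and \<Sigma> :: "real^'p^'p"
  assumes prob: "prob_space M"
    and group_size: "\<And>i. i \<ge> 1 \<Longrightarrow> l i \<ge> 1"
    and model: "\<And>i j \<omega>. (i, j) \<in> obs_index l \<Longrightarrow> \<omega> \<in> space M \<Longrightarrow>
                  y i j \<omega> = \<alpha> + x i j \<bullet> \<beta> + b i \<omega> + eps (i, j) \<omega>"
    and indep: "prob_space.indep_vars M (\<lambda>_. borel) (case_sum b eps) ({1..} <+> obs_index l)"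
    and b_ident: "\<And>i i'. i \<ge> 1 \<Longrightarrow> i' \<ge> 1 \<Longrightarrow> distr M borel (b i) = distr M borel (b i')"
    and eps_ident: "\<And>k k'. k \<in> obs_index l \<Longrightarrow> k' \<in> obs_index l \<Longrightarrow>
                      distr M borel (eps k) = distr M borel (eps k')"
    and b_mean: "\<And>i. i \<ge> 1 \<Longrightarrow> integrable M (b i) \<and> (\<integral>\<omega>. b i \<omega> \<partial>M) = 0"
    and eps_mean: "\<And>k. k \<in> obs_index l \<Longrightarrow> integrable M (eps k) \<and> (\<integral>\<omega>. eps k \<omega> \<partial>M) = 0"
    and b_var: "\<And>i. i \<ge> 1 \<Longrightarrow>
                  integrable M (\<lambda>\<omega>. (b i \<omega>)\<^sup>2) \<and> (\<integral>\<omega>. (b i \<omega>)\<^sup>2 \<partial>M) = \<gamma>b\<^sup>2"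
    and eps_var: "\<And>k. k \<in> obs_index l \<Longrightarrow>
                  integrable M (\<lambda>\<omega>. (eps k \<omega>)\<^sup>2) \<and> (\<integral>\<omega>. (eps k \<omega>)\<^sup>2 \<partial>M) = \<gamma>e\<^sup>2"
    and Sigma_pos_def: "pos_def \<Sigma>"
    and Sigma_lim: "(\<lambda>n. Sigma_hat l x n) \<longlonglongrightarrow> \<Sigma>"
    and inv_sizes: "(\<lambda>n. (1 / real n) * (\<Sum>i=1..n. 1 / real (l i))) \<longlonglongrightarrow> 0"
    and avg_size: "filterlim (\<lambda>n. real (total_size l n) / real n) at_top sequentially"
    and max_dev: "(\<lambda>n. Max {norm (x i j - group_mean l x i) | i j.
                              1 \<le> i \<and> i \<le> n \<and> 1 \<le> j \<and> j \<le> l i}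
                       / sqrt (real (total_size l n))) \<longlonglongrightarrow> 0"
    and means_bounded: "bounded (range (\<lambda>n. (1 / real n) *\<^sub>R (\<Sum>i=1..n. group_mean l x i)))"
  shows "weak_conv_gen
           (\<lambda>n. distr M borel (\<lambda>\<omega>.
              sqrt (real (total_size l n)) *\<^sub>R (beta_hat l x (\<lambda>i j. y i j \<omega>) n - \<beta>)))
           (mv_normal 0 (\<gamma>e\<^sup>2 *\<^sub>R matrix_inv \<Sigma>))
       \<and> weak_conv_m
           (\<lambda>n. distr M borel (\<lambda>\<omega>.
              sqrt (real n) * (alpha_hat l x (\<lambda>i j. y i j \<omega>) n - \<alpha>)))
           (normal_law 0 (\<gamma>b\<^sup>2))"
proof -
  interpret prob_space M by (rule prob)
  have b_indep: "indep_vars (\<lambda>_. borel) b {1..}"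
    using indep_vars_reindex[of Inl "{1..}" "\<lambda>_. borel" "case_sum b eps"]
      indep_vars_subset[OF indep, of "Inl ` {1..}"] by (simp add: Plus_def)
  have eps_indep: "indep_vars (\<lambda>_. borel) eps (obs_index l)"
    using indep_vars_reindex[of Inr "obs_index l" "\<lambda>_. borel" "case_sum b eps"]
      indep_vars_subset[OF indep, of "Inr ` obs_index l"] by (simp add: Plus_def)
  have b_rv: "random_variable borel (b i)" if "i \<ge> 1" for i
    using b_indep that unfolding indep_vars_def2 by blast
  have eps_rv: "random_variable borel (eps k)" if "k \<in> obs_index l" for k
    using eps_indep that unfolding indep_vars_def2 by blast

  define K where "K = obs_upto l"
  define d where "d = deviation l x"
  define N where "N n = real (total_size l n)" for n
  define Q where "Q n = matrix_inv (Sigma_hat l x n)" for n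
  define m where "m n = (1 / real n) *\<^sub>R (\<Sum>i=1..n. group_mean l x i)" for n
  have K: "finite (K n)" "K n \<subseteq> obs_index l" for n
    by (simp_all add: K_def finite_obs_upto obs_upto_subset)
  obtain c where c: "c > 0" "\<forall>\<^sub>F n in sequentially. \<forall>v. c * (v \<bullet> v) \<le> v \<bullet> (Sigma_hat l x n *v v)"
    using eventually_coercive[OF Sigma_lim Sigma_pos_def] .
  \<comment> \<open>for the finitely many other \<open>n\<close> nothing is known about \<open>matrix_inv\<close>, and the limits ignore them\<close>
  have regular: "\<forall>\<^sub>F n in sequentially. n \<ge> 1 \<and> N n > 0 \<and> invertible (Sigma_hat l x n) \<and> (\<forall>t. norm (Q n *v t) \<le> norm t / c)"
    using c(2) eventually_ge_at_top[of 1]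
  proof eventually_elim
    case (elim n)
    have "1 \<le> l 1" by (rule group_size) simp
    also have "\<dots> \<le> (\<Sum>i=1..n. l i)" using elim by (intro member_le_sum) auto
    finally have "N n > 0" unfolding N_def total_size_def by linarith
    thus ?case using elim coercive_inverse[OF c(1), of "Sigma_hat l x n"] by (auto simp: Q_def)
  qed
  have Q_lim: "(\<lambda>n. Q n *v t) \<longlonglongrightarrow> matrix_inv \<Sigma> *v t" for t
    unfolding Q_def by (rule tendsto_matrix_inv_mult_vec[OF Sigma_lim Sigma_pos_def])
  have Q_sym: "u \<bullet> (Q n *v v) = (Q n *v u) \<bullet> v" if "invertible (Sigma_hat l x n)" for n u v
    unfolding Q_def by (rule symmetric_inverse[OF transpose_Sigma_hat that])
  have square_sum: "(\<Sum>k\<in>K n. (t \<bullet> (Q n *v d k))\<^sup>2) / N n = t \<bullet> (Q n *v t)"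
    if "invertible (Sigma_hat l x n)" for n t
    unfolding Q_def K_def d_def N_def by (rule estimator_weights_square_sum[OF that])

  define D where "D n = Max {norm (x i j - group_mean l x i) | i j. 1 \<le> i \<and> i \<le> n \<and> 1 \<le> j \<and> j \<le> l i}" for n
  have d_le: "norm (d k) \<le> D n" if "k \<in> K n" for k n
    unfolding D_def
  proof (rule Max_ge)
    have "{norm (x i j - group_mean l x i) | i j. 1 \<le> i \<and> i \<le> n \<and> 1 \<le> j \<and> j \<le> l i}
        = (\<lambda>k. norm (d k)) ` K n"
      by (force simp: d_def deviation_def K_def obs_upto_def)
    thus "finite {norm (x i j - group_mean l x i) | i j. 1 \<le> i \<and> i \<le> n \<and> 1 \<le> j \<and> j \<le> l i}"
      "norm (d k) \<in> {norm (x i j - group_mean l x i) | i j. 1 \<le> i \<and> i \<le> n \<and> 1 \<le> j \<and> j \<le> l i}"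
      using K(1) that by auto
  qed

  \<comment> \<open>the slope: \<open>v n k\<close> is the coefficient of \<open>eps k\<close> in \<open>sqrt N * (beta_hat - \<beta>)\<close>\<close>
  define v where "v n k = (1 / sqrt (N n)) *\<^sub>R (Q n *v d k)" for n k
  have "weak_conv_gen (\<lambda>n. distr M borel (\<lambda>\<omega>. \<Sum>k\<in>K n. eps k \<omega> *\<^sub>R v n k)) (mv_normal 0 (\<gamma>e\<^sup>2 *\<^sub>R matrix_inv \<Sigma>))"
  proof (rule multivariate_weighted_sum_clt[OF eps_indep eps_ident eps_mean eps_var K(2,1)])
    show "\<exists>A::real^'p^'p. A ** transpose A = matrix_inv \<Sigma>"
      by (rule pos_def_inverse_factorization(2)[OF Sigma_pos_def])
    show "(\<lambda>n. \<Sum>k\<in>K n. (t \<bullet> v n k)\<^sup>2) \<longlonglongrightarrow> t \<bullet> (matrix_inv \<Sigma> *v t)" for t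
    proof (rule Lim_transform_eventually)
      show "(\<lambda>n. t \<bullet> (Q n *v t)) \<longlonglongrightarrow> t \<bullet> (matrix_inv \<Sigma> *v t)" by (intro tendsto_intros Q_lim)
      show "\<forall>\<^sub>F n in sequentially. t \<bullet> (Q n *v t) = (\<Sum>k\<in>K n. (t \<bullet> v n k)\<^sup>2)"
        using regular
        by eventually_elim (simp add: v_def power_divide sum_divide_distrib flip: square_sum)
    qed
    show "\<forall>\<^sub>F n in sequentially. \<forall>k\<in>K n. \<bar>t \<bullet> v n k\<bar> \<le> \<delta>" if "\<delta> > 0" for t and \<delta> :: real
    proof -
      have "(\<lambda>n. norm t / c * (D n / sqrt (N n))) \<longlonglongrightarrow> norm t / c * 0"
        unfolding D_def N_def by (intro tendsto_intros max_dev)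
      hence "\<forall>\<^sub>F n in sequentially. norm t / c * (D n / sqrt (N n)) < \<delta>"
        using that by (intro order_tendstoD(2)) auto
      with regular show ?thesis
      proof eventually_elim
        case (elim n)
        show ?case
        proof
          fix k assume k: "k \<in> K n"
          have "\<bar>t \<bullet> v n k\<bar> = \<bar>(Q n *v t) \<bullet> d k\<bar> / sqrt (N n)"
            using elim Q_sym[of n t] by (simp add: v_def)
          also have "\<dots> \<le> (norm t / c * D n) / sqrt (N n)"
          proof (rule divide_right_mono)
            have "\<bar>(Q n *v t) \<bullet> d k\<bar> \<le> norm (Q n *v t) * norm (d k)" by (rule Cauchy_Schwarz_ineq2)
            also have "\<dots> \<le> norm t / c * D n" using elim d_le[OF k] c(1) by (intro mult_mono) auto
            finally show "\<bar>(Q n *v t) \<bullet> d k\<bar> \<le> norm t / c * D n" .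
          qed (use elim in simp)
          also have "\<dots> < \<delta>" using elim by simp
          finally show "\<bar>t \<bullet> v n k\<bar> \<le> \<delta>" by simp
        qed
      qed
    qed
  qed
  moreover have "\<forall>\<^sub>F n in sequentially. distr M borel (\<lambda>\<omega>. sqrt (real (total_size l n)) *\<^sub>R (beta_hat l x (\<lambda>i j. y i j \<omega>) n - \<beta>))
      = distr M borel (\<lambda>\<omega>. \<Sum>k\<in>K n. eps k \<omega> *\<^sub>R v n k)"
    using regular
  proof eventually_elim
    case (elim n)
    show ?case
    proof (rule distr_cong[OF refl refl])
      fix \<omega> assume \<omega>: "\<omega> \<in> space M"
      have "beta_hat l x (\<lambda>i j. y i j \<omega>) n - \<beta>
          = (\<Sum>k\<in>K n. eps k \<omega> *\<^sub>R ((1 / N n) *\<^sub>R (Q n *v d k)))"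
        unfolding K_def N_def Q_def d_def
        by (rule beta_hat_error[where \<alpha>=\<alpha> and b="\<lambda>i. b i \<omega>"]) (use group_size model \<omega> elim in auto)
      moreover have "sqrt (N n) * r / N n = r / sqrt (N n)" for r
        using elim by (simp add: field_simps)
      ultimately show "sqrt (real (total_size l n)) *\<^sub>R (beta_hat l x (\<lambda>i j. y i j \<omega>) n - \<beta>) = (\<Sum>k\<in>K n. eps k \<omega> *\<^sub>R v n k)"
        by (simp add: v_def scaleR_sum_right N_def[symmetric])
    qed
  qed
  ultimately have beta: "weak_conv_gen
           (\<lambda>n. distr M borel (\<lambda>\<omega>.
              sqrt (real (total_size l n)) *\<^sub>R (beta_hat l x (\<lambda>i j. y i j \<omega>) n - \<beta>)))
           (mv_normal 0 (\<gamma>e\<^sup>2 *\<^sub>R matrix_inv \<Sigma>))"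
    by (rule weak_conv_gen_cong_eventually[rotated])

  \<comment> \<open>the intercept: \<open>X n\<close> carries the limit law and \<open>Y n\<close> vanishes in mean square\<close>
  define g where "g n k = sqrt (real n) * (1 / (real n * real (l (fst k))) - m n \<bullet> (Q n *v d k) / N n)" for n k
  define Y where "Y n \<omega> = (\<Sum>k\<in>K n. g n k * eps k \<omega>)" for n \<omega>
  define X where "X n \<omega> = (\<Sum>i=1..n. (1 / sqrt (real n)) * b i \<omega>)" for n \<omega>
  have X_lim: "weak_conv_m (\<lambda>n. distr M borel (X n)) (normal_law 0 (\<gamma>b\<^sup>2))"
  proof -
    have "weak_conv_m (\<lambda>n. distr M borel (\<lambda>\<omega>. \<Sum>i=1..n. (1 / sqrt (real n)) * b i \<omega>)) (normal_law 0 (\<gamma>b\<^sup>2 * 1))"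
    proof (rule weighted_sum_clt[OF b_indep])
      show "(\<lambda>n. \<Sum>i = 1..n. (1 / sqrt (real n))\<^sup>2) \<longlonglongrightarrow> 1"
        by (rule Lim_transform_eventually[OF tendsto_const], rule eventually_mono[OF eventually_ge_at_top[of 1]])
          (simp add: power_divide)
      have root_lim: "(\<lambda>n. 1 / sqrt (real n)) \<longlonglongrightarrow> 0"
        by (intro tendsto_divide_0[OF tendsto_const] filterlim_at_top_imp_at_infinity
            filterlim_compose[OF sqrt_at_top filterlim_real_sequentially])
      show "\<forall>\<^sub>F n in sequentially. \<forall>i\<in>{1..n}. \<bar>1 / sqrt (real n)\<bar> \<le> \<delta>" if "\<delta> > 0" for \<delta> :: real
        by (rule eventually_mono[OF order_tendstoD(2)[OF root_lim that]]) simp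
      show "distr M borel (b i) = distr M borel (b i')" if "i \<in> {1..}" "i' \<in> {1..}" for i i'
        by (rule b_ident) (use that in auto)
      show "integrable M (b i) \<and> expectation (b i) = 0" if "i \<in> {1..}" for i
        by (rule b_mean) (use that in auto)
      show "integrable M (\<lambda>\<omega>. (b i \<omega>)\<^sup>2) \<and> expectation (\<lambda>\<omega>. (b i \<omega>)\<^sup>2) = \<gamma>b\<^sup>2" if "i \<in> {1..}" for i
        by (rule b_var) (use that in auto)
    qed auto
    thus ?thesis unfolding X_def by simp
  qed
  note second_moment = second_moment_weighted_sum[OF indep_vars_subset[OF eps_indep K(2)] K(1), where v = "\<gamma>e\<^sup>2"]
  have Y_sq: "integrable M (\<lambda>\<omega>. (Y n \<omega>)\<^sup>2)" "expectation (\<lambda>\<omega>. (Y n \<omega>)\<^sup>2) = \<gamma>e\<^sup>2 * (\<Sum>k\<in>K n. (g n k)\<^sup>2)" for n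
    unfolding Y_def by (intro second_moment; use eps_mean eps_var K(2)[of n] in blast)+
  obtain R where R: "norm (m n) \<le> R" for n
    using means_bounded by (auto simp: bounded_iff m_def)
  \<comment> \<open>\<open>(p - q)\<^sup>2 \<le> 2 p\<^sup>2 + 2 q\<^sup>2\<close> separates the two sources of noise: averaging within groups gives
     the mean of \<open>1 / l i\<close>, and the slope error gives \<open>n / N\<close> times a bounded quadratic form\<close>
  have "(\<lambda>n. \<Sum>k\<in>K n. (g n k)\<^sup>2) \<longlonglongrightarrow> 0"
  proof (rule Lim_null_comparison)
    show "\<forall>\<^sub>F n in sequentially. norm (\<Sum>k\<in>K n. (g n k)\<^sup>2)
        \<le> 2 * ((1 / real n) * (\<Sum>i=1..n. 1 / real (l i))) + 2 * (R * (R / c)) * inverse (N n / real n)"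
      using regular
    proof eventually_elim
      case (elim n)
      have "norm (\<Sum>k\<in>K n. (g n k)\<^sup>2) = (\<Sum>k\<in>K n. (g n k)\<^sup>2)" by (simp add: sum_nonneg)
      also have "\<dots> \<le> (\<Sum>k\<in>K n. 2 * (1 / (real n * (real (l (fst k)))\<^sup>2)) + 2 * (real n / N n) * ((m n \<bullet> (Q n *v d k))\<^sup>2 / N n))"
      proof (rule sum_mono)
        fix k
        have "(p - q)\<^sup>2 \<le> 2 * p\<^sup>2 + 2 * q\<^sup>2" for p q :: real
          using zero_le_power2[of "p + q"] by (simp add: power2_sum power2_diff)
        hence "(1 / (real n * real (l (fst k))) - m n \<bullet> (Q n *v d k) / N n)\<^sup>2
            \<le> 2 * (1 / (real n * real (l (fst k))))\<^sup>2 + 2 * (m n \<bullet> (Q n *v d k) / N n)\<^sup>2" .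
        hence "(g n k)\<^sup>2 \<le> real n * (2 * (1 / (real n * real (l (fst k))))\<^sup>2 + 2 * (m n \<bullet> (Q n *v d k) / N n)\<^sup>2)"
          by (simp add: g_def power_mult_distrib mult_left_mono)
        also have "\<dots> = 2 * (1 / (real n * (real (l (fst k)))\<^sup>2)) + 2 * (real n / N n) * ((m n \<bullet> (Q n *v d k))\<^sup>2 / N n)"
          using elim by (simp add: power_mult_distrib power_divide power2_eq_square algebra_simps)
        finally show "(g n k)\<^sup>2 \<le> 2 * (1 / (real n * (real (l (fst k)))\<^sup>2)) + 2 * (real n / N n) * ((m n \<bullet> (Q n *v d k))\<^sup>2 / N n)" .
      qed
      also have "\<dots> = 2 * (\<Sum>k\<in>K n. 1 / (real n * (real (l (fst k)))\<^sup>2)) + 2 * (real n / N n) * (m n \<bullet> (Q n *v m n))"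
        using square_sum[of n "m n"] elim
        by (simp only: sum.distrib sum_distrib_left[symmetric] sum_divide_distrib[symmetric])
      also have "(\<Sum>k\<in>K n. 1 / (real n * (real (l (fst k)))\<^sup>2)) = (1 / real n) * (\<Sum>i=1..n. 1 / real (l i))"
      proof -
        have "(\<Sum>k\<in>K n. 1 / (real n * (real (l (fst k)))\<^sup>2)) = (\<Sum>i=1..n. (1 / real n) * (1 / real (l i)))"
          unfolding K_def sum_obs_upto using group_size
          by (intro sum.cong refl) (simp add: power2_eq_square)
        thus ?thesis by (simp only: sum_distrib_left)
      qed
      also have "2 * (real n / N n) * (m n \<bullet> (Q n *v m n)) \<le> 2 * (real n / N n) * (R * (R / c))"
      proof (rule mult_left_mono)
        have "m n \<bullet> (Q n *v m n) \<le> norm (m n) * norm (Q n *v m n)" by (rule norm_cauchy_schwarz)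
        also have "\<dots> \<le> R * (R / c)"
        proof (rule mult_mono[OF R])
          have "norm (Q n *v m n) \<le> norm (m n) / c" using elim by blast
          also have "\<dots> \<le> R / c" using R c(1) by (intro divide_right_mono) auto
          finally show "norm (Q n *v m n) \<le> R / c" .
          show "0 \<le> R" using R[of 0] norm_ge_zero order_trans by blast
        qed simp
        finally show "m n \<bullet> (Q n *v m n) \<le> R * (R / c)" .
      qed (use elim in simp)
      finally show ?case by (simp add: mult_ac)
    qed
    have "(\<lambda>n. inverse (N n / real n)) \<longlonglongrightarrow> 0"
      using tendsto_inverse_0_at_top[OF avg_size] by (simp add: N_def)
    hence "(\<lambda>n. 2 * ((1 / real n) * (\<Sum>i=1..n. 1 / real (l i))) + 2 * (R * (R / c)) * inverse (N n / real n))
        \<longlonglongrightarrow> 2 * 0 + 2 * (R * (R / c)) * 0"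
      by (intro tendsto_intros inv_sizes)
    thus "(\<lambda>n. 2 * ((1 / real n) * (\<Sum>i=1..n. 1 / real (l i))) + 2 * (R * (R / c)) * inverse (N n / real n)) \<longlonglongrightarrow> 0"
      by simp
  qed
  hence Y_lim: "(\<lambda>n. expectation (\<lambda>\<omega>. (Y n \<omega>)\<^sup>2)) \<longlonglongrightarrow> 0"
    unfolding Y_sq by (rule tendsto_mult_right_zero)
  have "weak_conv_m (\<lambda>n. distr M borel (\<lambda>\<omega>. X n \<omega> + Y n \<omega>)) (normal_law 0 (\<gamma>b\<^sup>2))"
  proof (rule slutsky_mean_square[OF _ _ real_distribution_normal_law X_lim Y_sq(1) Y_lim])
    show "random_variable borel (X n)" for n
      unfolding X_def by (intro borel_measurable_sum borel_measurable_times b_rv) auto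
    show "random_variable borel (Y n)" for n
      unfolding Y_def using K(2)[of n] by (intro borel_measurable_sum borel_measurable_times eps_rv) auto
  qed
  moreover have "\<forall>\<^sub>F n in sequentially. distr M borel (\<lambda>\<omega>. sqrt (real n) * (alpha_hat l x (\<lambda>i j. y i j \<omega>) n - \<alpha>))
      = distr M borel (\<lambda>\<omega>. X n \<omega> + Y n \<omega>)"
    using regular
  proof eventually_elim
    case (elim n)
    show ?case
    proof (rule distr_cong[OF refl refl])
      fix \<omega> assume \<omega>: "\<omega> \<in> space M"
      have "alpha_hat l x (\<lambda>i j. y i j \<omega>) n - \<alpha> = (\<Sum>i=1..n. (1 / real n) * b i \<omega>) +
          (\<Sum>k\<in>K n. (1 / (real n * real (l (fst k))) - m n \<bullet> (Q n *v d k) / N n) * eps k \<omega>)"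
        unfolding K_def N_def Q_def d_def
        by (rule alpha_hat_error[where \<beta>=\<beta>]) (use group_size model \<omega> elim m_def in auto)
      moreover have "sqrt (real n) * (1 / real n) = 1 / sqrt (real n)"
        using elim by (simp add: real_div_sqrt field_simps)
      ultimately show "sqrt (real n) * (alpha_hat l x (\<lambda>i j. y i j \<omega>) n - \<alpha>) = X n \<omega> + Y n \<omega>"
        by (simp only: distrib_left sum_distrib_left X_def Y_def g_def mult.assoc[symmetric])
    qed
  qed
  ultimately have "weak_conv_m
           (\<lambda>n. distr M borel (\<lambda>\<omega>.
              sqrt (real n) * (alpha_hat l x (\<lambda>i j. y i j \<omega>) n - \<alpha>)))
           (normal_law 0 (\<gamma>b\<^sup>2))"
    by (rule weak_conv_m_cong_eventually[rotated])
  with beta show ?thesis by blast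
qed

end
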